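(* Let $G$ be a Lie group acting smoothly and properly on a smooth manifold $M$, and let $R=M/G$ be the orbit space, equipped with the quotient topology and the differential structure $C^\infty(R)$. Let $f:R\to\mathbb{R}$ be a continuous function. Then for any $\delta>0$ there exists $g\in C^\infty(R)$ such that $$|g(y)-f(y)|<\delta\quad\text{for any } y\in R.$$
   Context: Smooth manifolds are Hausdorff and second countable. Let $\rho:M\to R=M/G$ be the canonical projection (orbit map). $R$ carries the quotient topology: $V\subseteq R$ is open iff $\rho^{-1}(V)$ is open in $M$. The differential structure (the set of smooth real-valued functions) on $R$ is $$C^\infty(R)=\{h:R\to\mathbb{R}\mid \rho^*h=h\circ\rho\in C^\infty(M)\}.$$ *)

theory Defs
  imports "HOL-Analysis.Analysis"
begin

(* Model spaces of manifolds: finite-dimensional Euclidean spaces. The class euclidean_space is not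
   used because it forces DIM('a) > 0; the class below also has a zero-dimensional instance (any
   one-point inner product space), so that discrete, in particular finite, Lie groups are included. *)
class findim_inner = real_inner +
  assumes findim: "\<exists>B. finite B \<and> (\<forall>x. \<exists>c. x = (\<Sum>b\<in>B. c b *\<^sub>R b))"

lemma ex_finite_spanning: "\<exists>B :: 'a::findim_inner set. finite B \<and> span B = UNIV"
proof -
  obtain B :: "'a set" where B: "finite B" "\<And>x. \<exists>c. x = (\<Sum>b\<in>B. c b *\<^sub>R b)"
    using findim by blast
  then have "span B = UNIV"
    by (auto simp: span_finite)
  with B(1) show ?thesis by blast
qed

instance euclidean_space \<subseteq> findim_inner
proof
  show "\<exists>B :: 'a set. finite B \<and> (\<forall>x. \<exists>c. x = (\<Sum>b\<in>B. c b *\<^sub>R b))"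
    by (metis finite_Basis euclidean_representation)
qed

instance prod :: (findim_inner, findim_inner) findim_inner
proof
  obtain A :: "'a set" where A: "finite A" "span A = UNIV"
    using ex_finite_spanning by blast
  obtain B :: "'b set" where B: "finite B" "span B = UNIV"
    using ex_finite_spanning by blast
  let ?C = "(\<lambda>a. (a, 0)) ` A \<union> (\<lambda>b. (0, b)) ` B :: ('a \<times> 'b) set"
  have lin: "linear (\<lambda>a::'a. (a, 0::'b))" "linear (\<lambda>b::'b. (0::'a, b))"
    by (auto intro!: linearI)
  have "(x, y) \<in> span ?C" for x y
  proof -
    have "(x, 0) \<in> span ((\<lambda>a. (a, 0::'b)) ` A)"
      using A(2) linear_span_image[OF lin(1), of A] by auto
    moreover have "(0, y) \<in> span ((\<lambda>b. (0::'a, b)) ` B)"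
      using B(2) linear_span_image[OF lin(2), of B] by auto
    ultimately have "(x, 0) + (0, y) \<in> span ?C"
      by (meson span_add span_mono subsetD sup_ge1 sup_ge2)
    then show ?thesis by simp
  qed
  moreover have C: "finite ?C"
    using A(1) B(1) by auto
  ultimately have "\<exists>c. z = (\<Sum>b\<in>?C. c b *\<^sub>R b)" for z
    by (cases z) (auto simp: span_finite[OF C])
  with C show "\<exists>C :: ('a \<times> 'b) set. finite C \<and> (\<forall>x. \<exists>c. x = (\<Sum>b\<in>C. c b *\<^sub>R b))"
    by blast
qed

(* C^k regularity on an open set: all iterated directional derivatives up to order k exist and are
   continuous. Only ever applied to open S. *)
primrec Ck_on :: "nat \<Rightarrow> 'a::real_normed_vector set \<Rightarrow> ('a \<Rightarrow> 'b::real_normed_vector) \<Rightarrow> bool" where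
  "Ck_on 0 S f \<longleftrightarrow> continuous_on S f"
| "Ck_on (Suc k) S f \<longleftrightarrow>
     (\<forall>x\<in>S. f differentiable (at x)) \<and> (\<forall>v. Ck_on k S (\<lambda>x. frechet_derivative f (at x) v))"

definition smooth_on :: "'a::real_normed_vector set \<Rightarrow> ('a \<Rightarrow> 'b::real_normed_vector) \<Rightarrow> bool" where
  "smooth_on S f \<longleftrightarrow> (\<forall>k. Ck_on k S f)"

(* A chart is a pair of its domain and a map whose values outside the domain are irrelevant. *)
type_synonym ('m, 'e) atlas = "('m set \<times> ('m \<Rightarrow> 'e)) set"

definition is_chart :: "'m::topological_space set \<Rightarrow> ('m \<Rightarrow> 'e::findim_inner) \<Rightarrow> bool" where
  "is_chart U \<phi> \<longleftrightarrow> open U \<and> open (\<phi> ` U) \<and> (\<exists>\<psi>. homeomorphism U (\<phi> ` U) \<phi> \<psi>)"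

(* The manifold is the whole type; the smooth structure is given by any (not necessarily maximal)
   smooth atlas. Its dimension is the dimension of the model space. *)
definition smooth_manifold ::
    "('m::{t2_space, second_countable_topology}, 'e::findim_inner) atlas \<Rightarrow> bool" where
  "smooth_manifold A \<longleftrightarrow>
     (\<forall>(U, \<phi>)\<in>A. is_chart U \<phi>) \<and>
     (\<Union>(U, \<phi>)\<in>A. U) = UNIV \<and>
     (\<forall>(U, \<phi>)\<in>A. \<forall>(V, \<psi>)\<in>A. smooth_on (\<phi> ` (U \<inter> V)) (\<psi> \<circ> inv_into U \<phi>))"

definition prod_atlas :: "('m, 'e) atlas \<Rightarrow> ('n, 'd) atlas \<Rightarrow> ('m \<times> 'n, 'e \<times> 'd) atlas" where
  "prod_atlas A B = {(U \<times> V, map_prod \<phi> \<psi>) | U \<phi> V \<psi>. (U, \<phi>) \<in> A \<and> (V, \<psi>) \<in> B}"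

definition smooth_map ::
    "('m::topological_space, 'e::findim_inner) atlas \<Rightarrow>
     ('n::topological_space, 'd::findim_inner) atlas \<Rightarrow> ('m \<Rightarrow> 'n) \<Rightarrow> bool" where
  "smooth_map A B F \<longleftrightarrow>
     continuous_on UNIV F \<and>
     (\<forall>(U, \<phi>)\<in>A. \<forall>(V, \<psi>)\<in>B. smooth_on (\<phi> ` (U \<inter> F -` V)) (\<psi> \<circ> F \<circ> inv_into U \<phi>))"

definition smooth_functions ::
    "('m::topological_space, 'e::findim_inner) atlas \<Rightarrow> ('m \<Rightarrow> real) set" where
  "smooth_functions A = {h. \<forall>(U, \<phi>)\<in>A. smooth_on (\<phi> ` U) (h \<circ> inv_into U \<phi>)}"

(* The class group_add is that of arbitrary, not necessarily commutative, groups; the group law is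
   written +, the inverse unary minus and the neutral element 0. *)
definition lie_group ::
    "('g::{group_add, t2_space, second_countable_topology}, 'e::findim_inner) atlas \<Rightarrow> bool" where
  "lie_group A \<longleftrightarrow>
     smooth_manifold A \<and>
     smooth_map (prod_atlas A A) A (\<lambda>(g, h). g + h) \<and>
     smooth_map A A uminus"

definition smooth_action ::
    "('g::{group_add, topological_space}, 'd::findim_inner) atlas \<Rightarrow>
     ('m::topological_space, 'e::findim_inner) atlas \<Rightarrow> ('g \<Rightarrow> 'm \<Rightarrow> 'm) \<Rightarrow> bool" where
  "smooth_action A B act \<longleftrightarrow>
     (\<forall>x. act 0 x = x) \<and>
     (\<forall>g h x. act (g + h) x = act g (act h x)) \<and>
     smooth_map (prod_atlas A B) B (\<lambda>(g, x). act g x)"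

definition proper_action ::
    "('g::topological_space \<Rightarrow> 'm::topological_space \<Rightarrow> 'm) \<Rightarrow> bool" where
  "proper_action act \<longleftrightarrow> proper_map euclidean euclidean (\<lambda>(g, x). (act g x, x))"

definition orbit_map :: "('g \<Rightarrow> 'm \<Rightarrow> 'm) \<Rightarrow> 'm \<Rightarrow> 'm set" where
  "orbit_map act x = range (\<lambda>g. act g x)"

definition orbit_space :: "('g \<Rightarrow> 'm \<Rightarrow> 'm) \<Rightarrow> 'm set set" where
  "orbit_space act = range (orbit_map act)"

definition orbit_topology :: "('g \<Rightarrow> 'm::topological_space \<Rightarrow> 'm) \<Rightarrow> 'm set topology" where
  "orbit_topology act = topology (\<lambda>V. V \<subseteq> orbit_space act \<and> open (orbit_map act -` V))"

lemma openin_orbit_topology: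
  "openin (orbit_topology act) V \<longleftrightarrow> V \<subseteq> orbit_space act \<and> open (orbit_map act -` V)"
proof -
  have "istopology (\<lambda>V. V \<subseteq> orbit_space act \<and> open (orbit_map act -` V))"
    unfolding istopology_def by (auto simp: vimage_Union)
  then show ?thesis
    by (simp add: orbit_topology_def topology_inverse')
qed

lemma topspace_orbit_topology: "topspace (orbit_topology act) = orbit_space act"
proof -
  have "orbit_map act -` orbit_space act = UNIV"
    by (auto simp: orbit_space_def)
  then have "openin (orbit_topology act) (orbit_space act)"
    by (simp add: openin_orbit_topology)
  then show ?thesis
    by (metis openin_orbit_topology openin_subset openin_topspace subset_antisym)
qed

(* Functions on the orbit space are represented by total functions on sets of points; only their
   values on the orbits matter. *)
definition orbit_smooth_functions ::
    "('m::topological_space, 'e::findim_inner) atlas \<Rightarrow> ('g \<Rightarrow> 'm \<Rightarrow> 'm) \<Rightarrow> ('m set \<Rightarrow> real) set"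
  where "orbit_smooth_functions A act = {h. h \<circ> orbit_map act \<in> smooth_functions A}"

end

theory Submission
  imports Defs
begin

text \<open>
  Bump functions on \<open>M\<close> become invariant when they are averaged over the orbits with a right
  invariant positive functional \<open>J\<close> on compactly supported functions on the group,
  i.e. by passing from \<open>\<beta>\<close> to \<open>\<lambda>x. J (\<lambda>g. \<beta> (act g x))\<close>; properness makes the averages finite
  and smooth. Since \<open>M\<close> is second countable, countably many invariant bumps, each supported where
  \<open>f\<close> oscillates by less than \<open>\<delta>\<close>, cover \<open>M\<close>. After they have been cut down to a locally
  finite family, the correspondingly weighted average of values of \<open>f\<close> is smooth, invariant and
  within \<open>\<delta>\<close> of \<open>f\<close>. The functional \<open>J\<close> is Haar measure in Weil's construction by covering
  numbers.
\<close>

section \<open>Calculus of smooth functions\<close>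

text \<open>The group need not be compact, so a smooth approximant of
  \<open>f \<circ> orbit_map act\<close> on the manifold cannot itself be averaged: its orbit
  integrals would in general diverge. Only compactly supported bumps are averaged, and division by a
  locally finite total replaces the normalisation that a probability measure would supply. Invariant
  open sets may fail to be relatively compact, which is why local finiteness is forced by extra
  factors rather than by a choice of the cover.

  The functional is not given by a measure but only through linearity, positivity and invariance.
  Differentiation under it is therefore done by hand: a uniform estimate on a compact set is turned
  into an estimate of functionals by a compactly supported majorant that is at least 1 there.
  Properness provides one such compact set for all parameters in a small ball.

  Model spaces may have dimension 0, so coordinates are taken in a finite orthogonal spanning
  set.\<close>

lemma Ck_on_imp_continuous_on: "Ck_on k S f \<Longrightarrow> continuous_on S f"
  by (cases k)
    (simp_all add: differentiable_imp_continuous_within continuous_at_imp_continuous_on)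

lemma Ck_on_SucD: "Ck_on (Suc k) S f \<Longrightarrow> Ck_on k S f"
proof (induction k arbitrary: f)
  case 0
  then show ?case
    using Ck_on_imp_continuous_on[OF 0] by simp
next
  case (Suc k)
  then show ?case
    by (metis Ck_on.simps(2))
qed

lemma Ck_on_subset: "Ck_on k S f \<Longrightarrow> T \<subseteq> S \<Longrightarrow> Ck_on k T f"
  by (induction k arbitrary: f) (auto intro: continuous_on_subset)

lemma frechet_derivative_cong_open:
  assumes "open S" "x \<in> S" "\<And>y. y \<in> S \<Longrightarrow> f y = g y"
  shows "frechet_derivative f (at x) = frechet_derivative g (at x)"
proof -
  have "(f has_derivative D) (at x) \<longleftrightarrow> (g has_derivative D) (at x)" for D
    using assms has_derivative_transform_within_open by metis
  then show ?thesis
    by (simp add: frechet_derivative_def)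
qed

lemma differentiable_cong_open:
  assumes "open S" "x \<in> S" "\<And>y. y \<in> S \<Longrightarrow> f y = g y"
  shows "f differentiable (at x) \<longleftrightarrow> g differentiable (at x)"
  unfolding differentiable_def using assms has_derivative_transform_within_open by metis

lemma Ck_on_cong:
  assumes "open S" "\<And>x. x \<in> S \<Longrightarrow> f x = g x"
  shows "Ck_on k S f \<longleftrightarrow> Ck_on k S g"
  using assms(2)
proof (induction k arbitrary: f g)
  case 0
  then show ?case by (simp cong: continuous_on_cong)
next
  case (Suc k)
  have "Ck_on k S (\<lambda>x. frechet_derivative f (at x) v) \<longleftrightarrow> Ck_on k S (\<lambda>x. frechet_derivative g (at x) v)" for v
    using frechet_derivative_cong_open[OF assms(1) _ Suc.prems] by (intro Suc.IH) simp
  with differentiable_cong_open[OF assms(1) _ Suc.prems] show ?case by simp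
qed

text \<open>\<open>frechet_derivative\<close> is a choice operator. Uniqueness of derivatives lets
  the closure lemmas below work with an explicit formula \<open>D\<close>, and openness of
  \<open>S\<close> lets that formula replace the chosen one at every order.\<close>

lemma Ck_on_SucI:
  assumes "open S" "\<And>x. x \<in> S \<Longrightarrow> (f has_derivative D x) (at x)" "\<And>v. Ck_on k S (\<lambda>x. D x v)"
  shows "Ck_on (Suc k) S f"
proof -
  have "frechet_derivative f (at x) v = D x v" if "x \<in> S" for x v
    using assms(2)[OF that] by (metis frechet_derivative_at)
  then have "Ck_on k S (\<lambda>x. frechet_derivative f (at x) v)" for v
    using assms(3)[of v] by (subst Ck_on_cong[OF assms(1)])
  with assms(2) show ?thesis
    by (auto simp: differentiable_def)
qed

lemma Ck_on_has_derivative: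
  "Ck_on (Suc k) S f \<Longrightarrow> x \<in> S \<Longrightarrow> (f has_derivative frechet_derivative f (at x)) (at x)"
  by (simp add: frechet_derivative_works)

lemma Ck_on_local:
  assumes "\<And>x. x \<in> S \<Longrightarrow> \<exists>T. open T \<and> x \<in> T \<and> Ck_on k T f"
  shows "Ck_on k S f"
  using assms
proof (induction k arbitrary: f)
  case 0
  then have "isCont f x" if "x \<in> S" for x
    using that by (metis Ck_on.simps(1) continuous_on_eq_continuous_at)
  then show ?case
    by (simp add: continuous_at_imp_continuous_on)
next
  case (Suc k)
  show ?case
    unfolding Ck_on.simps
  proof (intro conjI ballI allI)
    fix v show "Ck_on k S (\<lambda>x. frechet_derivative f (at x) v)"
      using Suc.prems by (intro Suc.IH) (metis Ck_on.simps(2))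
  qed (use Suc.prems in \<open>metis Ck_on.simps(2)\<close>)
qed

lemma Ck_on_const: "Ck_on k S (\<lambda>x. c)"
  by (induction k arbitrary: c) (auto simp: frechet_derivative_const)

lemma Ck_on_linear:
  assumes "bounded_linear f"
  shows "Ck_on k S f"
proof (cases k)
  case (Suc m)
  have "(f has_derivative f) (at x)" for x
    by (rule bounded_linear_imp_has_derivative[OF assms])
  then have "frechet_derivative f (at x) = f" "(f has_derivative f) (at x)" for x
    by (metis frechet_derivative_at)+
  then show ?thesis
    unfolding Suc by (auto simp: differentiable_def Ck_on_const)
qed (simp add: assms linear_continuous_on)

lemma Ck_on_add:
  assumes "open S" "Ck_on k S f" "Ck_on k S g"
  shows "Ck_on k S (\<lambda>x. f x + g x)"
  using assms(2,3)
proof (induction k arbitrary: f g)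
  case (Suc k)
  show ?case
  proof (rule Ck_on_SucI[OF assms(1)])
    fix x assume "x \<in> S"
    then show "((\<lambda>x. f x + g x) has_derivative
        (\<lambda>v. frechet_derivative f (at x) v + frechet_derivative g (at x) v)) (at x)"
      by (intro has_derivative_add Ck_on_has_derivative[OF Suc.prems(1)] Ck_on_has_derivative[OF Suc.prems(2)])
  qed (use Suc in auto)
qed (auto intro: continuous_intros)

lemma (in bounded_bilinear) Ck_on:
  assumes "open S" "Ck_on k S f" "Ck_on k S g"
  shows "Ck_on k S (\<lambda>x. prod (f x) (g x))"
  using assms(2,3)
proof (induction k arbitrary: f g)
  case 0
  then show ?case by (simp add: continuous_on)
next
  case (Suc k)
  show ?case
  proof (rule Ck_on_SucI[OF assms(1)])
    fix x assume "x \<in> S"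
    then show "((\<lambda>x. prod (f x) (g x)) has_derivative
        (\<lambda>v. prod (f x) (frechet_derivative g (at x) v) + prod (frechet_derivative f (at x) v) (g x))) (at x)"
      by (intro FDERIV Ck_on_has_derivative[OF Suc.prems(1)] Ck_on_has_derivative[OF Suc.prems(2)])
  next
    fix v
    show "Ck_on k S (\<lambda>x. prod (f x) (frechet_derivative g (at x) v) + prod (frechet_derivative f (at x) v) (g x))"
      using Suc.prems Suc.prems[THEN Ck_on_SucD] by (intro Ck_on_add assms(1) Suc.IH) simp_all
  qed
qed

lemmas Ck_on_mult = bounded_bilinear.Ck_on[OF bounded_bilinear_mult]
  and Ck_on_scaleR = bounded_bilinear.Ck_on[OF bounded_bilinear_scaleR]
  and Ck_on_inner = bounded_bilinear.Ck_on[OF bounded_bilinear_inner]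

lemma Ck_on_sum:
  assumes "open S" "\<And>i. i \<in> I \<Longrightarrow> Ck_on k S (f i)"
  shows "Ck_on k S (\<lambda>x. \<Sum>i\<in>I. f i x)"
  using assms(2) by (induction I rule: infinite_finite_induct) (auto intro: Ck_on_const Ck_on_add assms(1))

text \<open>Gram-Schmidt without normalisation. The set may contain 0, whose coefficient is a
  division by zero and whose term vanishes anyway. The coordinates become explicit bounded
  functionals, which the chain rule and the differentiation under the functional rely on.\<close>

lemma ex_orthogonal_expansion:
  "\<exists>B :: 'a::findim_inner set. finite B \<and> (\<forall>x. x = (\<Sum>b\<in>B. (x \<bullet> b / (b \<bullet> b)) *\<^sub>R b))"
proof -
  obtain B :: "'a set" where "finite B" "span B = UNIV"
    using ex_finite_spanning by blast
  then obtain C :: "'a set" where C: "finite C" "span C = UNIV" "pairwise orthogonal C"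
    using basis_orthogonal[of B] by auto
  have "x = (\<Sum>b\<in>C. (x \<bullet> b / (b \<bullet> b)) *\<^sub>R b)" for x
  proof -
    obtain c where x: "x = (\<Sum>b\<in>C. c b *\<^sub>R b)"
      using C(1,2) by (auto simp: span_finite)
    have "x \<bullet> b = c b * (b \<bullet> b)" if b: "b \<in> C" for b
    proof -
      have "x \<bullet> b = (\<Sum>a\<in>C. c a * (a \<bullet> b))"
        by (simp add: x inner_sum_left)
      also have "\<dots> = (\<Sum>a\<in>C. if a = b then c a * (a \<bullet> b) else 0)"
        using C(3) b by (intro sum.cong) (auto simp: pairwise_def orthogonal_def)
      finally show ?thesis using b C(1) by simp
    qed
    then have "(x \<bullet> b / (b \<bullet> b)) *\<^sub>R b = c b *\<^sub>R b" if "b \<in> C" for b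
      using that by (cases "b = 0") auto
    then have "(\<Sum>b\<in>C. (x \<bullet> b / (b \<bullet> b)) *\<^sub>R b) = (\<Sum>b\<in>C. c b *\<^sub>R b)"
      by (intro sum.cong refl)
    with x show ?thesis by metis
  qed
  with C(1) show ?thesis by blast
qed

text \<open>\<open>Ck_on\<close> tests derivatives in a fixed direction, but the direction that the
  chain rule feeds into the derivative of \<open>g\<close> moves with \<open>x\<close>. Expanding it
  over \<open>B\<close> leaves fixed directions \<open>b\<close> with variable coefficients, and the
  induction hypothesis applies to the derivative of \<open>g\<close> in each of them.\<close>

lemma Ck_on_compose:
  fixes f :: "'a::real_normed_vector \<Rightarrow> 'b::findim_inner" and g :: "'b \<Rightarrow> 'c::real_normed_vector"
  assumes "open S" "f ` S \<subseteq> T" "Ck_on k S f" "Ck_on k T g"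
  shows "Ck_on k S (\<lambda>x. g (f x))"
  using assms(3,4)
proof (induction k arbitrary: g)
  case 0
  then show ?case
    using assms(2) by (auto intro: continuous_on_compose2)
next
  case (Suc k)
  obtain B :: "'b set" where B: "finite B" "\<And>x. x = (\<Sum>b\<in>B. (x \<bullet> b / (b \<bullet> b)) *\<^sub>R b)"
    using ex_orthogonal_expansion by blast
  let ?D = "\<lambda>x v. \<Sum>b\<in>B. (frechet_derivative f (at x) v \<bullet> (b /\<^sub>R (b \<bullet> b))) *\<^sub>R frechet_derivative g (at (f x)) b"
  show ?case
  proof (rule Ck_on_SucI[OF assms(1)])
    fix x assume x: "x \<in> S"
    have g: "(g has_derivative frechet_derivative g (at (f x))) (at (f x))"
      using Suc.prems(2) assms(2) x Ck_on_has_derivative by blast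
    have "frechet_derivative g (at (f x)) w
      = (\<Sum>b\<in>B. (w \<bullet> (b /\<^sub>R (b \<bullet> b))) *\<^sub>R frechet_derivative g (at (f x)) b)" for w
    proof -
      interpret g: bounded_linear "frechet_derivative g (at (f x))"
        using g by (rule has_derivative_bounded_linear)
      show ?thesis
        by (subst B(2)[of w]) (simp add: g.sum g.scaleR divide_inverse mult.commute)
    qed
    then have "(\<lambda>v. frechet_derivative g (at (f x)) (frechet_derivative f (at x) v)) = ?D x"
      by (intro ext)
    then show "((\<lambda>x. g (f x)) has_derivative ?D x) (at x)"
      using has_derivative_compose[OF Ck_on_has_derivative[OF Suc.prems(1) x] g] by (simp only:)
  next
    fix v
    have "Ck_on k S (\<lambda>x. frechet_derivative g (at (f x)) b)" for b
      using Suc.prems Ck_on_SucD[OF Suc.prems(1)] by (intro Suc.IH) simp_all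
    moreover have "Ck_on k S (\<lambda>x. frechet_derivative f (at x) v)"
      using Suc.prems by simp
    ultimately show "Ck_on k S (\<lambda>x. ?D x v)"
      by (intro Ck_on_sum Ck_on_scaleR Ck_on_inner Ck_on_const assms(1))
  qed
qed

text \<open>The derivative is a polynomial in \<open>inverse\<close> itself, so order
  \<open>k\<close> of the function yields order \<open>Suc k\<close>.\<close>

lemma Ck_on_inverse: "Ck_on k (- {0::real}) inverse"
proof (induction k)
  case 0
  show ?case by (auto intro: continuous_on_inverse)
next
  case (Suc k)
  have op: "open (- {0::real})"
    by (rule open_Compl) simp
  show ?case
  proof (rule Ck_on_SucI[OF op])
    fix x :: real assume "x \<in> - {0}"
    then show "(inverse has_derivative (\<lambda>v. - v * (inverse x * inverse x))) (at x)"
      by (auto intro!: derivative_eq_intros)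
  qed (intro Ck_on_mult Suc Ck_on_const op)
qed

lemma Ck_on_smooth: "smooth_on S f \<Longrightarrow> Ck_on k S f"
  by (simp add: smooth_on_def)

lemma smooth_on_frechet_derivative:
  "smooth_on S f \<Longrightarrow> smooth_on S (\<lambda>x. frechet_derivative f (at x) v)"
  unfolding smooth_on_def by (metis Ck_on.simps(2))

lemma smooth_on_has_derivative:
  "smooth_on S f \<Longrightarrow> x \<in> S \<Longrightarrow> (f has_derivative frechet_derivative f (at x)) (at x)"
  using Ck_on_has_derivative Ck_on_smooth by blast

lemma smooth_on_imp_continuous_on: "smooth_on S f \<Longrightarrow> continuous_on S f"
  using Ck_on_imp_continuous_on Ck_on_smooth by blast

lemma smooth_on_subset: "smooth_on S f \<Longrightarrow> T \<subseteq> S \<Longrightarrow> smooth_on T f"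
  unfolding smooth_on_def using Ck_on_subset by blast

lemma smooth_on_cong:
  "open S \<Longrightarrow> (\<And>x. x \<in> S \<Longrightarrow> f x = g x) \<Longrightarrow> smooth_on S f \<longleftrightarrow> smooth_on S g"
  unfolding smooth_on_def using Ck_on_cong by blast

lemma smooth_on_local:
  "(\<And>x. x \<in> S \<Longrightarrow> \<exists>T. open T \<and> x \<in> T \<and> smooth_on T f) \<Longrightarrow> smooth_on S f"
  unfolding smooth_on_def by (meson Ck_on_local)

lemma smooth_on_const: "smooth_on S (\<lambda>x. c)"
  by (simp add: smooth_on_def Ck_on_const)

lemma smooth_on_add:
  "open S \<Longrightarrow> smooth_on S f \<Longrightarrow> smooth_on S g \<Longrightarrow> smooth_on S (\<lambda>x. f x + g x)"
  by (simp add: smooth_on_def Ck_on_add)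

lemma smooth_on_mult:
  fixes f g :: "'a::real_normed_vector \<Rightarrow> 'b::real_normed_algebra"
  shows "open S \<Longrightarrow> smooth_on S f \<Longrightarrow> smooth_on S g \<Longrightarrow> smooth_on S (\<lambda>x. f x * g x)"
  by (simp add: smooth_on_def Ck_on_mult)

lemma smooth_on_compose:
  fixes f :: "'a::real_normed_vector \<Rightarrow> 'b::findim_inner" and g :: "'b \<Rightarrow> 'c::real_normed_vector"
  shows "open S \<Longrightarrow> f ` S \<subseteq> T \<Longrightarrow> smooth_on S f \<Longrightarrow> smooth_on T g \<Longrightarrow> smooth_on S (\<lambda>x. g (f x))"
  unfolding smooth_on_def using Ck_on_compose by blast

text \<open>The powers of \<open>inverse t\<close> make the family closed under differentiation.\<close>

definition flat_exp :: "nat \<Rightarrow> real \<Rightarrow> real" where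
  "flat_exp n t = (if 0 < t then exp (- inverse t) * inverse t ^ n else 0)"

lemma flat_exp_pos_iff: "0 < flat_exp n t \<longleftrightarrow> 0 < t"
  by (simp add: flat_exp_def)

lemma flat_exp_nonneg: "0 \<le> flat_exp n t"
  by (simp add: flat_exp_def)

text \<open>With \<open>u = inverse t\<close> the right-hand limit is that of
  \<open>u ^ n / exp u\<close> at infinity. It will serve as the difference quotient at 0.\<close>

lemma tendsto_flat_exp: "(flat_exp n \<longlongrightarrow> 0) (at 0)"
proof (rule filterlim_split_at)
  have "((\<lambda>x. x ^ n / exp x) \<longlongrightarrow> 0) (at_top :: real filter)"
    by (rule tendsto_power_div_exp_0)
  then have "((\<lambda>t. inverse t ^ n / exp (inverse t)) \<longlongrightarrow> (0::real)) (at_right 0)"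
    using filterlim_inverse_at_top_right by (rule filterlim_compose)
  then show "(flat_exp n \<longlongrightarrow> 0) (at_right 0)"
    by (rule Lim_transform_eventually)
      (auto simp: flat_exp_def eventually_at_filter exp_minus divide_inverse)
  have "((\<lambda>t. 0) \<longlongrightarrow> (0::real)) (at_left 0)"
    by simp
  then show "(flat_exp n \<longlongrightarrow> 0) (at_left 0)"
    by (rule Lim_transform_eventually) (auto simp: flat_exp_def eventually_at_filter)
qed

lemma flat_exp_has_real_derivative:
  "(flat_exp n has_real_derivative flat_exp (n + 2) t - real n * flat_exp (n + 1) t) (at t)"
proof (cases t "0::real" rule: linorder_cases)
  case less
  have "((\<lambda>t. 0) has_real_derivative 0) (at t)"
    by simp
  then have "(flat_exp n has_real_derivative 0) (at t)"
    by (rule has_field_derivative_transform_within_open[where S="{..<0}"])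
      (use less in \<open>auto simp: flat_exp_def\<close>)
  then show ?thesis
    using less by (simp add: flat_exp_def)
next
  case equal
  \<comment> \<open>Dividing by \<open>h\<close> raises the power of \<open>inverse h\<close> by
    one, so the limit for \<open>n + 1\<close> says that the derivative at 0 is 0.\<close>
  have "(\<lambda>h. (flat_exp n (0 + h) - flat_exp n 0) / h) = flat_exp (n + 1)"
    by (auto simp: flat_exp_def fun_eq_iff divide_inverse)
  then show ?thesis
    using tendsto_flat_exp[of "n + 1"] equal by (simp add: DERIV_def flat_exp_def)
next
  case greater
  have "((\<lambda>t. inverse t ^ n) has_real_derivative - real n * inverse t ^ (n + 1)) (at t)"
    using DERIV_power[OF DERIV_inverse, of t n] greater by (cases n) (simp_all add: algebra_simps)
  moreover have "((\<lambda>t. exp (- inverse t)) has_real_derivative exp (- inverse t) * (inverse t * inverse t)) (at t)"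
    using greater by (auto intro!: derivative_eq_intros)
  ultimately have "((\<lambda>t. exp (- inverse t) * inverse t ^ n) has_real_derivative
      exp (- inverse t) * inverse t ^ (n + 2) - real n * (exp (- inverse t) * inverse t ^ (n + 1))) (at t)"
    by (rule DERIV_cong[OF DERIV_mult[rotated]]) (simp add: algebra_simps)
  then have "(flat_exp n has_real_derivative
      exp (- inverse t) * inverse t ^ (n + 2) - real n * (exp (- inverse t) * inverse t ^ (n + 1))) (at t)"
    by (rule has_field_derivative_transform_within_open[where S="{0<..}"])
      (use greater in \<open>auto simp: flat_exp_def\<close>)
  then show ?thesis
    using greater by (simp add: flat_exp_def)
qed

lemma smooth_on_flat_exp: "smooth_on S (flat_exp n)"
proof -
  have "Ck_on k UNIV (flat_exp n)" for k
  proof (induction k arbitrary: n)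
    case 0
    have "isCont (flat_exp n) t" for t
      using flat_exp_has_real_derivative by (rule DERIV_isCont)
    then show ?case
      by (simp add: continuous_at_imp_continuous_on)
  next
    case (Suc k)
    show ?case
    proof (rule Ck_on_SucI)
      fix t
      show "(flat_exp n has_derivative (\<lambda>v. (flat_exp (n + 2) t + (- real n) * flat_exp (n + 1) t) * v)) (at t)"
        using flat_exp_has_real_derivative[of n t] by (simp add: has_field_derivative_def)
    next
      show "Ck_on k UNIV (\<lambda>t. (flat_exp (n + 2) t + (- real n) * flat_exp (n + 1) t) * v)" for v
        by (intro Ck_on_mult Ck_on_add Ck_on_const Suc open_UNIV)
    qed simp
  qed
  then show ?thesis
    by (metis smooth_on_def smooth_on_subset subset_UNIV)
qed

text \<open>The squared norm is an inner product of smooth functions and hence smooth also at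
  \<open>a\<close>, where the norm itself need not be.\<close>

lemma smooth_on_bump: "smooth_on S (\<lambda>x::'a::real_inner. flat_exp 0 (r\<^sup>2 - (norm (x - a))\<^sup>2))"
proof -
  have *: "Ck_on k UNIV (\<lambda>x::'a. x - a)" for k
    using Ck_on_add[OF open_UNIV Ck_on_linear[OF bounded_linear_ident] Ck_on_const, of k "- a"] by simp
  have "Ck_on k UNIV (\<lambda>x. r\<^sup>2 + (-1) * ((x - a) \<bullet> (x - a)))" for k
    by (intro Ck_on_add Ck_on_mult Ck_on_inner Ck_on_const * open_UNIV)
  then have "smooth_on UNIV (\<lambda>x. r\<^sup>2 + (-1) * ((x - a) \<bullet> (x - a)))"
    by (simp only: smooth_on_def simp_thms)
  then have "smooth_on UNIV (\<lambda>x. flat_exp 0 (r\<^sup>2 + (-1) * ((x - a) \<bullet> (x - a))))"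
    by (rule smooth_on_compose[OF open_UNIV subset_UNIV _ smooth_on_flat_exp])
  then have "smooth_on UNIV (\<lambda>x. flat_exp 0 (r\<^sup>2 - (norm (x - a))\<^sup>2))"
    by (simp add: dot_square_norm)
  then show ?thesis
    by (rule smooth_on_subset) simp
qed

text \<open>A box of coefficients is a Minkowski sum of segments, compact by induction on the
  spanning set; the ball is a closed subset of such a box.\<close>

lemma compact_cball_findim: "compact (cball (a::'a::findim_inner) r)"
proof -
  obtain B :: "'a set" where B: "finite B" "\<And>x. x = (\<Sum>b\<in>B. (x \<bullet> b / (b \<bullet> b)) *\<^sub>R b)"
    using ex_orthogonal_expansion by blast
  have cpt: "compact {\<Sum>b\<in>C. c b *\<^sub>R b |c. \<forall>b\<in>C. \<bar>c b\<bar> \<le> m b}" if "finite C" for C :: "'a set" and m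
    using that
  proof (induction C rule: finite_induct)
    case (insert b C)
    let ?P = "{\<Sum>b\<in>C. c b *\<^sub>R b |c. \<forall>b\<in>C. \<bar>c b\<bar> \<le> m b}"
    have "{\<Sum>b\<in>insert b C. c b *\<^sub>R b |c. \<forall>b\<in>insert b C. \<bar>c b\<bar> \<le> m b}
      = {x + y |x y. x \<in> (\<lambda>t. t *\<^sub>R b) ` {- m b..m b} \<and> y \<in> ?P}" (is "?L = ?R")
    proof (intro equalityI subsetI)
      fix x assume "x \<in> ?L"
      then show "x \<in> ?R" using insert.hyps by (fastforce simp: abs_le_iff)
    next
      fix x assume "x \<in> ?R"
      then obtain t c where *: "x = t *\<^sub>R b + (\<Sum>b\<in>C. c b *\<^sub>R b)" "\<bar>t\<bar> \<le> m b" "\<forall>b\<in>C. \<bar>c b\<bar> \<le> m b"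
        by (auto simp: abs_le_iff)
      have "(\<Sum>i\<in>C. c i *\<^sub>R i) = (\<Sum>i\<in>C. (c(b := t)) i *\<^sub>R i)"
        using insert.hyps by (intro sum.cong) auto
      then show "x \<in> ?L"
        using * insert.hyps by (auto intro!: exI[of _ "c(b := t)"])
    qed
    moreover have "compact ((\<lambda>t. t *\<^sub>R b) ` {- m b..m b})"
      by (intro compact_continuous_image continuous_intros) auto
    ultimately show ?case
      using insert.IH by (simp only: compact_sums)
  qed simp
  \<comment> \<open>Cauchy-Schwarz bounds the coordinate along \<open>b\<close> by
    \<open>norm x * norm b / (b \<bullet> b)\<close>, and \<open>norm x \<le> norm a + r\<close> on
    the ball.\<close>
  let ?m = "\<lambda>b. (norm a + r) * norm b / (b \<bullet> b)"
  have "cball a r \<subseteq> {\<Sum>b\<in>B. c b *\<^sub>R b |c. \<forall>b\<in>B. \<bar>c b\<bar> \<le> ?m b}"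
  proof
    fix x assume "x \<in> cball a r"
    then have "norm x \<le> norm a + r"
      using norm_triangle_sub[of x a] by (simp add: dist_norm norm_minus_commute)
    then have "\<bar>x \<bullet> b\<bar> \<le> (norm a + r) * norm b" for b
      by (meson Cauchy_Schwarz_ineq2 mult_right_mono norm_ge_zero order_trans)
    then have "\<bar>x \<bullet> b / (b \<bullet> b)\<bar> \<le> ?m b" for b
      by (simp add: divide_right_mono)
    then show "x \<in> {\<Sum>b\<in>B. c b *\<^sub>R b |c. \<forall>b\<in>B. \<bar>c b\<bar> \<le> ?m b}"
      by (intro CollectI exI[of _ "\<lambda>b. x \<bullet> b / (b \<bullet> b)"] conjI ballI B(2))
  qed
  then show ?thesis
    using compact_Int_closed[OF cpt[OF B(1), of ?m] closed_cball[of a r]] by (simp only: inf.absorb2)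
qed

section \<open>Haar functionals on locally compact groups\<close>

definition Cc :: "('a::topological_space \<Rightarrow> real) set" where
  "Cc = {f. continuous_on UNIV f \<and> (\<exists>K. compact K \<and> (\<forall>x. x \<notin> K \<longrightarrow> f x = 0))}"

definition Cc_nonneg :: "('a::topological_space \<Rightarrow> real) set" where
  "Cc_nonneg = {f \<in> Cc. \<forall>x. 0 \<le> f x}"

lemma Cc_imp_continuous: "f \<in> Cc \<Longrightarrow> continuous_on UNIV f"
  by (simp add: Cc_def)

lemma Cc_nonnegD: "f \<in> Cc_nonneg \<Longrightarrow> f \<in> Cc" "f \<in> Cc_nonneg \<Longrightarrow> 0 \<le> f x"
  by (auto simp: Cc_nonneg_def)

lemma CcE:
  assumes "f \<in> Cc"
  obtains K where "compact K" "\<And>x. x \<notin> K \<Longrightarrow> f x = 0"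
  using assms by (auto simp: Cc_def)

lemma Cc_bounded:
  assumes "f \<in> Cc"
  obtains M where "0 < M" "\<And>x. \<bar>f x\<bar> \<le> M"
proof -
  obtain K where K: "compact K" "\<And>x. x \<notin> K \<Longrightarrow> f x = 0"
    using assms by (auto simp: Cc_def)
  have "compact (f ` K)"
    using assms K(1) by (intro compact_continuous_image) (auto intro: continuous_on_subset simp: Cc_def)
  then obtain M where M: "\<forall>x\<in>f ` K. \<bar>x\<bar> \<le> M"
    by (metis compact_imp_bounded bounded_real)
  have "\<bar>f x\<bar> \<le> max M 1" for x
    using M K(2)[of x] by (cases "x \<in> K") auto
  with that[of "max M 1"] show ?thesis
    by auto
qed

lemma Cc_dominated:
  assumes "f \<in> Cc" "continuous_on UNIV g" "\<And>x. f x = 0 \<Longrightarrow> g x = 0"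
  shows "g \<in> Cc"
  using assms unfolding Cc_def by blast

lemma Cc_add:
  assumes "f \<in> Cc" "g \<in> Cc"
  shows "(\<lambda>x. f x + g x) \<in> Cc"
proof -
  obtain K L where "compact K" "\<And>x. x \<notin> K \<Longrightarrow> f x = 0" "compact L" "\<And>x. x \<notin> L \<Longrightarrow> g x = 0"
    using assms by (meson CcE)
  then have "compact (K \<union> L) \<and> (\<forall>x. x \<notin> K \<union> L \<longrightarrow> f x + g x = 0)"
    by (simp add: compact_Un)
  then show ?thesis
    using assms by (auto simp: Cc_def intro!: continuous_intros)
qed

lemma Cc_cmult: "f \<in> Cc \<Longrightarrow> (\<lambda>x. c * f x) \<in> Cc"
  by (rule Cc_dominated) (auto intro!: continuous_intros simp: Cc_def)

lemma Cc_diff: "f \<in> Cc \<Longrightarrow> g \<in> Cc \<Longrightarrow> (\<lambda>x. f x - g x) \<in> Cc"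
  using Cc_add[of f "\<lambda>x. -1 * g x"] Cc_cmult[of g "-1"] by simp

lemma Cc_mult_continuous: "f \<in> Cc \<Longrightarrow> continuous_on UNIV h \<Longrightarrow> (\<lambda>x. f x * h x) \<in> Cc"
  by (rule Cc_dominated) (auto intro!: continuous_intros simp: Cc_def)

lemma Cc_zero: "(\<lambda>x. 0) \<in> Cc"
  using compact_empty by (auto simp: Cc_def)

lemma Cc_nonneg_zero: "(\<lambda>x. 0) \<in> Cc_nonneg"
  by (simp add: Cc_nonneg_def Cc_zero)

lemma Cc_nonneg_add: "f \<in> Cc_nonneg \<Longrightarrow> g \<in> Cc_nonneg \<Longrightarrow> (\<lambda>x. f x + g x) \<in> Cc_nonneg"
  by (simp add: Cc_nonneg_def Cc_add)

lemma Cc_nonneg_cmult: "f \<in> Cc_nonneg \<Longrightarrow> 0 \<le> c \<Longrightarrow> (\<lambda>x. c * f x) \<in> Cc_nonneg"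
  by (simp add: Cc_nonneg_def Cc_cmult)

lemma pos_part_Cc_nonneg: "f \<in> Cc \<Longrightarrow> (\<lambda>x. max (f x) 0) \<in> Cc_nonneg"
  unfolding Cc_nonneg_def
  by (auto intro!: Cc_dominated[of f] continuous_intros simp: Cc_def)

section \<open>Combinations of translates and covering numbers\<close>

text \<open>Coefficients and shifts form a list: concatenation then adds two combinations, and
  repeated shifts may stay side by side.\<close>

definition translates :: "(real \<times> 'g::plus) list \<Rightarrow> ('g \<Rightarrow> real) \<Rightarrow> 'g \<Rightarrow> real" where
  "translates xs \<phi> x = (\<Sum>(c, s)\<leftarrow>xs. c * \<phi> (x + s))"

definition weight :: "(real \<times> 'g) list \<Rightarrow> real" where
  "weight xs = sum_list (map fst xs)"

definition dominates :: "(real \<times> 'g::plus) list \<Rightarrow> ('g \<Rightarrow> real) \<Rightarrow> ('g \<Rightarrow> real) \<Rightarrow> bool" where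
  "dominates xs \<phi> f \<longleftrightarrow> (\<forall>(c, s)\<in>set xs. 0 \<le> c) \<and> (\<forall>x. f x \<le> translates xs \<phi> x)"

text \<open>Weil's covering number, usually written \<open>(f : \<phi>)\<close>.\<close>

definition cov :: "('g::plus \<Rightarrow> real) \<Rightarrow> ('g \<Rightarrow> real) \<Rightarrow> real" where
  "cov f \<phi> = Inf {weight xs |xs. dominates xs \<phi> f}"

lemma translates_simps [simp]:
  "translates [] \<phi> x = 0"
  "translates (p # xs) \<phi> x = fst p * \<phi> (x + snd p) + translates xs \<phi> x"
  "translates (xs @ ys) \<phi> x = translates xs \<phi> x + translates ys \<phi> x"
  by (simp_all add: translates_def case_prod_beta)

lemma weight_simps [simp]:
  "weight [] = 0" "weight (p # xs) = fst p + weight xs" "weight (xs @ ys) = weight xs + weight ys"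
  by (simp_all add: weight_def)

lemma weight_nonneg: "\<forall>(c, s)\<in>set xs. 0 \<le> c \<Longrightarrow> 0 \<le> weight xs"
  by (induction xs) auto

lemma translates_nonneg:
  "\<forall>(c, s)\<in>set xs. 0 \<le> c \<Longrightarrow> (\<And>x. 0 \<le> \<phi> x) \<Longrightarrow> 0 \<le> translates xs \<phi> x"
  by (induction xs) auto

lemma translates_ge_member:
  assumes "\<forall>(c, s)\<in>set xs. 0 \<le> c" "\<And>x. 0 \<le> \<phi> x" "(c, s) \<in> set xs"
  shows "c * \<phi> (x + s) \<le> translates xs \<phi> x"
  using assms
proof (induction xs)
  case (Cons p xs)
  have "0 \<le> translates xs \<phi> x"
    using Cons.prems by (intro translates_nonneg) auto
  moreover have "0 \<le> fst p * \<phi> (x + snd p)"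
    using Cons.prems by (auto simp: case_prod_beta)
  ultimately show ?case
    using Cons by (auto intro: add_increasing add_increasing2)
qed simp

lemma translates_le_weight:
  assumes "\<forall>(c, s)\<in>set xs. 0 \<le> c" "\<And>x. \<phi> x \<le> M"
  shows "translates xs \<phi> x \<le> weight xs * M"
  using assms(1)
proof (induction xs)
  case (Cons p xs)
  have "fst p * \<phi> (x + snd p) \<le> fst p * M"
    using Cons.prems assms(2) by (intro mult_left_mono) auto
  with Cons show ?case
    by (simp add: distrib_right)
qed simp

lemma dominates_scale:
  assumes "dominates xs \<phi> f" "0 \<le> c"
  shows "dominates (map (map_prod ((*) c) id) xs) \<phi> (\<lambda>x. c * f x)"
    and "weight (map (map_prod ((*) c) id) xs) = c * weight xs"
proof -
  have "translates (map (map_prod ((*) c) id) xs) \<phi> x = c * translates xs \<phi> x" for x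
    by (induction xs) (auto simp: algebra_simps)
  then show "dominates (map (map_prod ((*) c) id) xs) \<phi> (\<lambda>x. c * f x)"
    using assms by (fastforce simp: dominates_def intro: mult_left_mono mult_nonneg_nonneg)
  show "weight (map (map_prod ((*) c) id) xs) = c * weight xs"
    by (induction xs) (auto simp: algebra_simps)
qed

text \<open>Local compactness is encoded by \<open>ex_bump\<close>, that is, by test functions
  concentrated arbitrarily near 0. First countability lets a sequence of them exhaust the
  neighbourhoods of 0.\<close>

locale locally_compact_group =
  fixes G :: "'g::{group_add, t2_space, first_countable_topology} itself"
  assumes continuous_plus: "continuous_on UNIV (\<lambda>(x::'g, y). x + y)"
    and continuous_uminus: "continuous_on UNIV (uminus :: 'g \<Rightarrow> 'g)"
    and ex_bump: "\<And>V. open V \<Longrightarrow> (0::'g) \<in> V \<Longrightarrow> \<exists>\<phi>\<in>Cc_nonneg. 0 < \<phi> 0 \<and> (\<forall>x. x \<notin> V \<longrightarrow> \<phi> x = 0)"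
begin

lemma continuous_on_plus:
  fixes f g :: "'a::topological_space \<Rightarrow> 'g"
  assumes "continuous_on S f" "continuous_on S g"
  shows "continuous_on S (\<lambda>x. f x + g x)"
  using continuous_on_compose2[OF continuous_plus continuous_on_Pair[OF assms]] by simp

lemma Cc_translate:
  fixes f :: "'g \<Rightarrow> real"
  assumes "f \<in> Cc"
  shows "(\<lambda>x. f (x + s)) \<in> Cc"
proof -
  obtain K where K: "compact K" "\<And>x. x \<notin> K \<Longrightarrow> f x = 0"
    using assms by (auto simp: Cc_def)
  have cont: "continuous_on A (\<lambda>x::'g. x + t)" for A t
    by (intro continuous_on_plus continuous_intros)
  then have "compact ((\<lambda>x. x + - s) ` K)"
    by (rule compact_continuous_image[OF _ K(1)])
  moreover have "f (x + s) = 0" if "x \<notin> (\<lambda>x. x + - s) ` K" for x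
  proof (rule K(2))
    show "x + s \<notin> K"
      using that by (force simp: image_iff add.assoc)
  qed
  moreover have "continuous_on UNIV (\<lambda>x. f (x + s))"
    by (rule continuous_on_compose2[OF Cc_imp_continuous[OF assms] cont]) simp
  ultimately show ?thesis
    by (auto simp: Cc_def)
qed

lemma Cc_nonneg_translate: "f \<in> Cc_nonneg \<Longrightarrow> (\<lambda>x::'g. f (x + s)) \<in> Cc_nonneg"
  by (simp add: Cc_nonneg_def Cc_translate)

lemma Cc_nonneg_translates:
  "\<forall>(c, s)\<in>set xs. 0 \<le> c \<Longrightarrow> \<phi> \<in> Cc_nonneg \<Longrightarrow> translates xs \<phi> \<in> (Cc_nonneg :: ('g \<Rightarrow> real) set)"
proof (induction xs)
  case Nil
  then show ?case by (simp add: translates_def Cc_nonneg_zero)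
next
  case (Cons p xs)
  then have "(\<lambda>x. fst p * \<phi> (x + snd p) + translates xs \<phi> x) \<in> Cc_nonneg"
    by (intro Cc_nonneg_add Cc_nonneg_cmult Cc_nonneg_translate) auto
  then show ?case
    by (metis (no_types, lifting) ext translates_simps(2))
qed

lemma ex_dominates_compact:
  fixes K :: "'g set"
  assumes "compact K" "\<phi> \<in> Cc_nonneg" "0 < \<phi> 0"
  shows "\<exists>xs. (\<forall>(c, s)\<in>set xs. 0 \<le> c) \<and> (\<forall>x\<in>K. 1 \<le> translates xs \<phi> x)"
proof -
  \<comment> \<open>At \<open>x = s\<close> the translate takes the value \<open>\<phi> 0\<close>,
    so half of it is exceeded on a neighbourhood of \<open>s\<close>; the coefficients
    \<open>2 / \<phi> 0\<close> below compensate for the half.\<close>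
  let ?U = "\<lambda>s. {x. \<phi> 0 / 2 < \<phi> (x + - s)}"
  have "open (?U s)" for s
    using Cc_nonneg_translate[OF assms(2)] Cc_nonnegD(1) Cc_imp_continuous
    by (intro open_Collect_less continuous_intros) blast
  then obtain D where D: "D \<subseteq> K" "finite D" "K \<subseteq> (\<Union>s\<in>D. ?U s)"
    using compactE_image[OF assms(1), of K ?U] assms(3) by (metis (no_types, lifting)
        UN_I add.right_inverse field_sum_of_halves less_add_same_cancel1 half_gt_zero mem_Collect_eq subsetI)
  then obtain ds where ds: "set ds = D"
    using finite_list by blast
  let ?xs = "map (\<lambda>s. (2 / \<phi> 0, - s)) ds"
  have nonneg: "\<forall>(c, s)\<in>set ?xs. 0 \<le> c"
    using assms(3) by auto
  have "1 \<le> translates ?xs \<phi> x" if x: "x \<in> K" for x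
  proof -
    obtain s where s: "s \<in> D" "\<phi> 0 / 2 < \<phi> (x + - s)"
      using D(3) x by blast
    have "2 / \<phi> 0 * \<phi> (x + - s) \<le> translates ?xs \<phi> x"
      using s(1) ds by (intro translates_ge_member nonneg Cc_nonnegD(2)[OF assms(2)]) auto
    moreover have "1 \<le> 2 / \<phi> 0 * \<phi> (x + - s)"
      using s(2) assms(3) by (simp add: field_simps)
    ultimately show ?thesis by simp
  qed
  with nonneg show ?thesis by blast
qed

text \<open>This keeps the infimum in \<open>cov f \<phi>\<close> from running over the empty set,
  where it would carry no information.\<close>

lemma ex_dominates:
  assumes "f \<in> Cc_nonneg" "\<phi> \<in> Cc_nonneg" "0 < \<phi> (0::'g)"
  shows "\<exists>xs. dominates xs \<phi> f"
proof -
  obtain K where K: "compact K" "\<And>x. x \<notin> K \<Longrightarrow> f x = 0"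
    using Cc_nonnegD(1)[OF assms(1)] CcE by blast
  obtain M where M: "0 < M" "\<And>x. \<bar>f x\<bar> \<le> M"
    using Cc_nonnegD(1)[OF assms(1)] Cc_bounded by blast
  obtain xs where xs: "\<forall>(c, s)\<in>set xs. 0 \<le> c" "\<forall>x\<in>K. 1 \<le> translates xs \<phi> x"
    using ex_dominates_compact[OF K(1) assms(2,3)] by blast
  have "f x / M \<le> translates xs \<phi> x" for x
  proof (cases "x \<in> K")
    case True
    have "f x \<le> M" using M(2)[of x] by simp
    then have "f x / M \<le> 1" using M(1) by simp
    with xs(2) True show ?thesis by fastforce
  next
    case False
    with K(2) translates_nonneg[OF xs(1) Cc_nonnegD(2)[OF assms(2)]] show ?thesis by simp
  qed
  then have "dominates xs \<phi> (\<lambda>x. f x / M)"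
    using xs(1) by (simp add: dominates_def)
  from dominates_scale(1)[OF this, of M] M(1) show ?thesis
    by auto
qed

lemma cov_le_weight: "dominates xs \<phi> f \<Longrightarrow> cov f \<phi> \<le> weight xs"
  unfolding cov_def dominates_def
  by (rule cInf_lower) (auto intro!: bdd_belowI[of _ 0] weight_nonneg)

context
  fixes \<phi> :: "'g \<Rightarrow> real"
  assumes \<phi>: "\<phi> \<in> Cc_nonneg" "0 < \<phi> 0"
begin

text \<open>The greatest-lower-bound rule with a factor in front, as required for the factor
  \<open>1 + 2 * \<epsilon>\<close> in the approximate additivity.\<close>

lemma le_mult_cov:
  assumes f: "f \<in> Cc_nonneg" and "0 \<le> a" and le: "\<And>xs. dominates xs \<phi> f \<Longrightarrow> b \<le> a * weight xs"
  shows "b \<le> a * cov f \<phi>"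
proof (cases "a = 0")
  case True
  then show ?thesis using le ex_dominates[OF f \<phi>] by auto
next
  case False
  with \<open>0 \<le> a\<close> have "0 < a" by simp
  have "b / a \<le> cov f \<phi>"
    unfolding cov_def
  proof (rule cInf_greatest)
    show "{weight xs |xs. dominates xs \<phi> f} \<noteq> {}"
      using ex_dominates[OF f \<phi>] by blast
  qed (use le \<open>0 < a\<close> in \<open>auto simp: field_simps\<close>)
  then show ?thesis using \<open>0 < a\<close> by (simp add: field_simps)
qed

lemmas le_cov = le_mult_cov[where a=1, simplified]

lemma cov_nonneg: "f \<in> Cc_nonneg \<Longrightarrow> 0 \<le> cov f \<phi>"
  by (intro le_cov weight_nonneg) (auto simp: dominates_def)

text \<open>A combination dominating \<open>f\<close> must reach \<open>f x\<close>, but its values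
  are at most its weight times a bound \<open>M\<close> of \<open>\<phi>\<close>; so
  \<open>f x / M\<close> is a lower bound for all weights.\<close>

lemma cov_pos:
  assumes "f \<in> Cc_nonneg" "0 < f x"
  shows "0 < cov f \<phi>"
proof -
  obtain M where M: "0 < M" "\<And>x. \<bar>\<phi> x\<bar> \<le> M"
    using Cc_nonnegD(1)[OF \<phi>(1)] Cc_bounded by blast
  have "f x / M \<le> cov f \<phi>"
  proof (rule le_cov[OF assms(1)])
    fix xs assume "dominates xs \<phi> f"
    then have "f x \<le> translates xs \<phi> x" "translates xs \<phi> x \<le> weight xs * M"
      using M(2) by (auto simp: dominates_def abs_le_iff intro!: translates_le_weight)
    then show "f x / M \<le> weight xs"
      using M(1) by (simp add: field_simps)
  qed
  with assms(2) M(1) show ?thesis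
    by (smt (verit) divide_pos_pos)
qed

lemma cov_mono:
  assumes "g \<in> Cc_nonneg" "\<And>x. f x \<le> g x"
  shows "cov f \<phi> \<le> cov g \<phi>"
proof (rule le_cov[OF assms(1)])
  fix xs assume "dominates xs \<phi> g"
  then have "dominates xs \<phi> f"
    unfolding dominates_def using assms(2) order_trans by blast
  then show "cov f \<phi> \<le> weight xs" by (rule cov_le_weight)
qed

lemma cov_translate_le:
  assumes "f \<in> Cc_nonneg"
  shows "cov (\<lambda>x. f (x + t)) \<phi> \<le> cov f \<phi>"
proof (rule le_cov[OF assms])
  fix xs assume xs: "dominates xs \<phi> f"
  \<comment> \<open>The new shift is \<open>t + s\<close>, in this order:
    \<open>(x + t) + s = x + (t + s)\<close>, and the group need not be commutative.\<close>
  let ?ys = "map (map_prod id ((+) t)) xs"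
  have "translates ?ys \<phi> x = translates xs \<phi> (x + t)" for x
    by (induction xs) (auto simp: add.assoc)
  then have "dominates ?ys \<phi> (\<lambda>x. f (x + t))"
    using xs by (auto simp: dominates_def)
  moreover have "weight ?ys = weight xs"
    by (induction xs) auto
  ultimately show "cov (\<lambda>x. f (x + t)) \<phi> \<le> weight xs"
    using cov_le_weight by metis
qed

lemma cov_translate:
  assumes "f \<in> Cc_nonneg"
  shows "cov (\<lambda>x. f (x + t)) \<phi> = cov f \<phi>"
proof (rule antisym)
  show "cov f \<phi> \<le> cov (\<lambda>x. f (x + t)) \<phi>"
    using cov_translate_le[OF Cc_nonneg_translate[OF assms, of t], of "- t"] by (simp add: add.assoc)
qed (rule cov_translate_le[OF assms])

lemma cov_add:
  assumes f: "f \<in> Cc_nonneg" and g: "g \<in> Cc_nonneg"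
  shows "cov (\<lambda>x. f x + g x) \<phi> \<le> cov f \<phi> + cov g \<phi>"
proof -
  have "cov (\<lambda>x. f x + g x) \<phi> - cov f \<phi> \<le> cov g \<phi>"
  proof (rule le_cov[OF g])
    fix ys assume ys: "dominates ys \<phi> g"
    have "cov (\<lambda>x. f x + g x) \<phi> - weight ys \<le> cov f \<phi>"
    proof (rule le_cov[OF f])
      fix xs assume "dominates xs \<phi> f"
      with ys have "dominates (xs @ ys) \<phi> (\<lambda>x. f x + g x)"
        by (auto simp: dominates_def intro!: add_mono)
      from cov_le_weight[OF this]
      show "cov (\<lambda>x. f x + g x) \<phi> - weight ys \<le> weight xs"
        by simp
    qed
    then show "cov (\<lambda>x. f x + g x) \<phi> - cov f \<phi> \<le> weight ys" by simp
  qed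
  then show ?thesis by simp
qed

lemma cov_cmult_le:
  assumes "f \<in> Cc_nonneg" "0 \<le> c"
  shows "cov (\<lambda>x. c * f x) \<phi> \<le> c * cov f \<phi>"
  using le_mult_cov[OF assms] dominates_scale[OF _ assms(2)] cov_le_weight by metis

lemma cov_cmult:
  assumes "f \<in> Cc_nonneg" "0 \<le> c"
  shows "cov (\<lambda>x. c * f x) \<phi> = c * cov f \<phi>"
proof (cases "c = 0")
  case True
  then show ?thesis
    using cov_cmult_le[OF assms] cov_nonneg[OF Cc_nonneg_zero] by simp
next
  case False
  with cov_cmult_le[OF Cc_nonneg_cmult[OF assms], of "inverse c"] assms(2)
  have "c * cov f \<phi> \<le> cov (\<lambda>x. c * f x) \<phi>"
    by (simp add: field_simps mult.assoc[symmetric])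
  with cov_cmult_le[OF assms] show ?thesis by simp
qed

lemma cov_translates:
  assumes "\<forall>(c, s)\<in>set xs. 0 \<le> c" "\<psi> \<in> Cc_nonneg"
  shows "cov (translates xs \<psi>) \<phi> \<le> weight xs * cov \<psi> \<phi>"
  using assms(1)
proof (induction xs)
  case Nil
  have "dominates [] \<phi> (translates [] \<psi>)"
    by (simp add: dominates_def)
  from cov_le_weight[OF this] show ?case by (simp del: translates_simps)
next
  case (Cons p xs)
  have eq: "translates (p # xs) \<psi> = (\<lambda>x. fst p * \<psi> (x + snd p) + translates xs \<psi> x)"
    by auto
  have p: "0 \<le> fst p" using Cons.prems by (auto simp: case_prod_beta)
  have "cov (translates (p # xs) \<psi>) \<phi> \<le> cov (\<lambda>x. fst p * \<psi> (x + snd p)) \<phi> + cov (translates xs \<psi>) \<phi>"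
    unfolding eq using Cons.prems p assms(2)
    by (intro cov_add Cc_nonneg_cmult Cc_nonneg_translate Cc_nonneg_translates) auto
  also have "cov (\<lambda>x. fst p * \<psi> (x + snd p)) \<phi> \<le> fst p * cov \<psi> \<phi>"
    using cov_cmult_le[OF Cc_nonneg_translate[OF assms(2)] p] cov_translate[OF assms(2)] by metis
  also have "cov (translates xs \<psi>) \<phi> \<le> weight xs * cov \<psi> \<phi>"
    using Cons by simp
  finally show ?case
    by (simp add: algebra_simps del: translates_simps)
qed

text \<open>In a combination of translates of \<open>\<psi>\<close> above \<open>f\<close>, each
  translate costs at most \<open>cov \<psi> \<phi>\<close> by invariance. With \<open>\<psi>\<close>
  fixed this bounds the normalised covering numbers independently of \<open>\<phi>\<close>, which is
  the source of compactness in the limit argument.\<close>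

lemma cov_trans:
  assumes "f \<in> Cc_nonneg" "\<psi> \<in> Cc_nonneg" "0 < \<psi> 0"
  shows "cov f \<phi> \<le> cov f \<psi> * cov \<psi> \<phi>"
proof -
  obtain xs0 where "dominates xs0 \<psi> f"
    using ex_dominates[OF assms] by blast
  have *: "cov f \<phi> \<le> weight xs * cov \<psi> \<phi>" if "dominates xs \<psi> f" for xs
    using cov_mono[OF Cc_nonneg_translates[of xs, OF _ assms(2)], of f]
      cov_translates[of xs, OF _ assms(2)] that
    unfolding dominates_def by (meson order_trans)
  have "0 < cov \<psi> \<phi>"
    by (rule cov_pos[OF assms(2,3)])
  then have "cov f \<phi> / cov \<psi> \<phi> \<le> cov f \<psi>"
    unfolding cov_def[of f \<psi>]
    using * \<open>dominates xs0 \<psi> f\<close> by (intro cInf_greatest) (auto simp: field_simps)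
  with \<open>0 < cov \<psi> \<phi>\<close> show ?thesis
    by (simp add: field_simps)
qed

end

section \<open>Additivity in the limit of concentrated functions\<close>

text \<open>The perturbation stands on the left because the application has \<open>v = x + s\<close>
  and \<open>t = - s\<close>, so that \<open>v + t = x\<close>.\<close>

lemma Cc_uniformly_continuous:
  fixes f :: "'g \<Rightarrow> real"
  assumes "f \<in> Cc" "0 < e"
  obtains V where "open V" "0 \<in> V" "\<And>v t. v \<in> V \<Longrightarrow> \<bar>f (v + t) - f t\<bar> < e"
proof -
  obtain K where K: "compact K" "\<And>x. x \<notin> K \<Longrightarrow> f x = 0"
    using assms(1) by (auto simp: Cc_def)
  let ?W = "{p. \<bar>f (fst p + snd p) - f (snd p)\<bar> < e}"
  note f = continuous_on_compose2[OF Cc_imp_continuous[OF assms(1)]]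
  have "continuous_on UNIV (\<lambda>p::'g \<times> 'g. f (fst p + snd p))"
    by (rule f) (auto intro!: continuous_on_plus continuous_intros)
  moreover have "continuous_on UNIV (\<lambda>p::'g \<times> 'g. f (snd p))"
    by (rule f) (auto intro!: continuous_intros)
  ultimately have W: "open ?W"
    by (intro open_Collect_less continuous_intros)
  have "{0} \<times> K \<subseteq> ?W"
    using assms(2) by auto
  then obtain X where X: "0 \<in> X" "open X" "X \<times> K \<subseteq> ?W"
    using Elementary_Topology.tube_lemma[OF K(1) W, of 0] by auto
  show ?thesis
  proof
    \<comment> \<open>Symmetry of the neighbourhood settles the case where \<open>t\<close> is
      outside \<open>K\<close> but \<open>v + t\<close> is inside: there the tube is applied to the
      pair \<open>(- v, v + t)\<close>.\<close>
    show "open (X \<inter> uminus -` X)"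
      using X(2) continuous_uminus by (intro open_Int open_vimage) auto
    show "0 \<in> X \<inter> uminus -` X"
      using X(1) by simp
    fix v t assume v: "v \<in> X \<inter> uminus -` X"
    show "\<bar>f (v + t) - f t\<bar> < e"
    proof (cases "t \<in> K")
      case True
      with v X(3) show ?thesis by auto
    next
      case t: False
      show ?thesis
      proof (cases "v + t \<in> K")
        case True
        with v X(3) have "(- v, v + t) \<in> ?W" by auto
        then show ?thesis by (simp flip: add.assoc add: abs_minus_commute)
      next
        case False
        with t K(2) assms(2) show ?thesis by simp
      qed
    qed
  qed
qed

text \<open>A concentrated \<open>\<phi>\<close> sees the ratios of \<open>f\<close> and
  \<open>g\<close> to their sum as nearly constant, so each translate covering the sum can be split
  between \<open>f\<close> and \<open>g\<close> at little cost. The error is measured by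
  \<open>cov f0 \<phi>\<close> because that is the later normalisation.\<close>

lemma approx_additive:
  assumes f: "f \<in> Cc_nonneg" and g: "g \<in> Cc_nonneg" and f0: "f0 \<in> Cc_nonneg" "0 < f0 0" and "0 < e"
  obtains V where "open V" "(0::'g) \<in> V"
    "\<And>\<phi>. \<phi> \<in> Cc_nonneg \<Longrightarrow> 0 < \<phi> 0 \<Longrightarrow> (\<And>x. x \<notin> V \<Longrightarrow> \<phi> x = 0) \<Longrightarrow>
      cov f \<phi> + cov g \<phi> \<le> cov (\<lambda>x. f x + g x) \<phi> + e * cov f0 \<phi>"
proof -
  define p where "p x = f x + g x" for x
  have p: "p \<in> Cc_nonneg"
    unfolding p_def using f g by (rule Cc_nonneg_add)
  obtain K where K: "compact K" "\<And>x. x \<notin> K \<Longrightarrow> p x = 0"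
    using Cc_nonnegD(1)[OF p] CcE by blast
  obtain us where us: "\<forall>(c, s)\<in>set us. 0 \<le> c" "\<forall>x\<in>K. 1 \<le> translates us f0 x"
    using ex_dominates_compact[OF K(1) f0] by blast
  define F where "F = translates us f0"
  have F: "F \<in> Cc_nonneg"
    unfolding F_def using us(1) f0(1) by (rule Cc_nonneg_translates)
  \<comment> \<open>Two errors of size \<open>\<eta> * cov F f0\<close> and two of size
    \<open>\<epsilon> * cov p f0\<close> will occur, hence the 4; the summand 1 keeps the
    denominators positive.\<close>
  define \<eta> where "\<eta> = e / (4 * (1 + cov F f0))"
  have covF: "0 \<le> cov F f0" "0 \<le> cov p f0"
    using cov_nonneg[OF f0] F p by auto
  then have \<eta>: "0 < \<eta>" "2 * (\<eta> * cov F f0) \<le> e / 2"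
    using \<open>0 < e\<close> by (auto simp: \<eta>_def field_simps)
  define \<epsilon> where "\<epsilon> = e / (4 * (1 + cov p f0))"
  have \<epsilon>: "0 < \<epsilon>" "2 * (\<epsilon> * cov p f0) \<le> e / 2"
    using \<open>0 < e\<close> covF by (auto simp: \<epsilon>_def field_simps)
  have den: "0 < p x + \<eta>" for x
    using Cc_nonnegD(2)[OF p, of x] \<eta>(1) by linarith
  have Cc_quot: "(\<lambda>x. q x * inverse (p x + \<eta>)) \<in> Cc" if "q \<in> Cc_nonneg" for q
    using Cc_imp_continuous[OF Cc_nonnegD(1)[OF p]] den
    by (intro Cc_mult_continuous Cc_nonnegD(1)[OF that] continuous_intros) (auto simp: less_imp_neq[symmetric])
  \<comment> \<open>The constant \<open>\<eta>\<close> keeps the quotients continuous where \<open>p\<close> vanishes.\<close>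
  define hf hg where "hf x = f x * inverse (p x + \<eta>)" and "hg x = g x * inverse (p x + \<eta>)" for x
  have hf: "hf \<in> Cc" and hg: "hg \<in> Cc"
    unfolding hf_def hg_def using Cc_quot f g by auto
  have hnn: "0 \<le> hf x" "0 \<le> hg x" for x
    using den[of x] Cc_nonnegD(2)[OF f, of x] Cc_nonnegD(2)[OF g, of x] by (auto simp: hf_def hg_def)
  have hsum: "hf x + hg x \<le> 1" for x
    using den[of x] \<eta>(1) by (simp add: hf_def hg_def p_def flip: distrib_right) (simp add: field_simps)
  obtain V where V: "open V" "0 \<in> V" "\<And>v t. v \<in> V \<Longrightarrow> \<bar>hf (v + t) - hf t\<bar> < \<epsilon>"
    using Cc_uniformly_continuous[OF hf \<epsilon>(1)] by blast
  obtain W where W: "open W" "0 \<in> W" "\<And>v t. v \<in> W \<Longrightarrow> \<bar>hg (v + t) - hg t\<bar> < \<epsilon>"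
    using Cc_uniformly_continuous[OF hg \<epsilon>(1)] by blast
  show ?thesis
  proof (rule that[of "V \<inter> W"])
    fix \<phi> :: "'g \<Rightarrow> real"
    assume \<phi>: "\<phi> \<in> Cc_nonneg" "0 < \<phi> 0" and supp: "\<And>x. x \<notin> V \<inter> W \<Longrightarrow> \<phi> x = 0"
    \<comment> \<open>The translate by \<open>s\<close> is nonzero only where \<open>x + s\<close>
      lies in \<open>V \<inter> W\<close>, and there \<open>h x\<close> exceeds
      \<open>h (- s)\<close> by less than \<open>\<epsilon>\<close>; so scaling its coefficient by
      \<open>h (- s) + \<epsilon>\<close> dominates the product.\<close>
    have product: "dominates (map (\<lambda>(c, s). (c * (h (- s) + \<epsilon>), s)) xs) \<phi> (\<lambda>x. p x * h x)"
      if h: "\<And>x. 0 \<le> h x" "\<And>v t. v \<in> V \<inter> W \<Longrightarrow> \<bar>h (v + t) - h t\<bar> < \<epsilon>"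
        and xs: "dominates xs \<phi> p" for h xs
    proof -
      have "translates xs \<phi> x * h x \<le> translates (map (\<lambda>(c, s). (c * (h (- s) + \<epsilon>), s)) xs) \<phi> x"
        if "\<forall>(c, s)\<in>set xs. 0 \<le> c" for x
        using that
      proof (induction xs)
        case (Cons q xs)
        obtain c s where q: "q = (c, s)" by (cases q)
        have "\<phi> (x + s) * h x \<le> \<phi> (x + s) * (h (- s) + \<epsilon>)"
        proof (cases "x + s \<in> V \<inter> W")
          case True
          from h(2)[OF this, of "- s"] have "h x \<le> h (- s) + \<epsilon>"
            by (simp add: add.assoc)
          then show ?thesis
            using Cc_nonnegD(2)[OF \<phi>(1)] by (intro mult_left_mono)
        next
          case False
          with supp show ?thesis by simp
        qed
        then have "c * (\<phi> (x + s) * h x) \<le> c * (\<phi> (x + s) * (h (- s) + \<epsilon>))"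
          by (rule mult_left_mono) (use Cons.prems q in auto)
        moreover have "translates xs \<phi> x * h x \<le> translates (map (\<lambda>(c, s). (c * (h (- s) + \<epsilon>), s)) xs) \<phi> x"
          using Cons by simp
        ultimately have "c * (\<phi> (x + s) * h x) + translates xs \<phi> x * h x
          \<le> c * (\<phi> (x + s) * (h (- s) + \<epsilon>)) + translates (map (\<lambda>(c, s). (c * (h (- s) + \<epsilon>), s)) xs) \<phi> x"
          by (rule add_mono)
        then show ?case
          by (simp add: q algebra_simps)
      qed simp
      moreover have "p x * h x \<le> translates xs \<phi> x * h x" for x
        using xs h(1) by (auto simp: dominates_def intro!: mult_right_mono)
      ultimately show ?thesis
        using xs h(1) \<epsilon>(1)
        by (fastforce simp: dominates_def intro: order_trans add_nonneg_nonneg)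
    qed
    \<comment> \<open>The same combination above \<open>p\<close> is rescaled by \<open>hf\<close>
      and by \<open>hg\<close>; the new weights add up well because \<open>hf + hg \<le> 1\<close>,
      and \<open>\<epsilon>\<close> enters once for each.\<close>
    have "cov (\<lambda>x. p x * hf x) \<phi> + cov (\<lambda>x. p x * hg x) \<phi> \<le> (1 + 2 * \<epsilon>) * cov p \<phi>"
    proof (rule le_mult_cov[OF \<phi> p])
      fix xs assume xs: "dominates xs \<phi> p"
      have "cov (\<lambda>x. p x * hf x) \<phi> \<le> weight (map (\<lambda>(c, s). (c * (hf (- s) + \<epsilon>), s)) xs)"
        using V(3) by (intro cov_le_weight product hnn xs) auto
      moreover have "cov (\<lambda>x. p x * hg x) \<phi> \<le> weight (map (\<lambda>(c, s). (c * (hg (- s) + \<epsilon>), s)) xs)"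
        using W(3) by (intro cov_le_weight product hnn xs) auto
      moreover have "weight (map (\<lambda>(c, s). (c * (hf (- s) + \<epsilon>), s)) xs)
          + weight (map (\<lambda>(c, s). (c * (hg (- s) + \<epsilon>), s)) xs) \<le> (1 + 2 * \<epsilon>) * weight xs"
        if "\<forall>(c, s)\<in>set xs. 0 \<le> c"
        using that
      proof (induction xs)
        case (Cons q xs)
        obtain c s where q: "q = (c, s)" by (cases q)
        have "c * (hf (- s) + hg (- s)) \<le> c * 1"
          using Cons.prems q by (intro mult_left_mono hsum) auto
        with Cons q show ?case
          by (auto simp: algebra_simps)
      qed simp
      ultimately show "cov (\<lambda>x. p x * hf x) \<phi> + cov (\<lambda>x. p x * hg x) \<phi> \<le> (1 + 2 * \<epsilon>) * weight xs"
        using xs by (auto simp: dominates_def)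
    qed (use \<epsilon>(1) in simp)
    moreover have "cov q \<phi> \<le> cov (\<lambda>x. p x * h x) \<phi> + \<eta> * cov F \<phi>"
      if q: "q \<in> Cc_nonneg" "\<And>x. q x \<le> p x" and h: "h = (\<lambda>x. q x * inverse (p x + \<eta>))" for q h
    proof -
      have hCc: "h \<in> Cc_nonneg"
        unfolding h Cc_nonneg_def using Cc_quot[OF q(1)] Cc_nonnegD(2)[OF q(1)] den
        by (auto intro!: mult_nonneg_nonneg simp: less_imp_le)
      have pCc: "(\<lambda>x. p x * h x) \<in> Cc_nonneg"
        unfolding Cc_nonneg_def
        using Cc_mult_continuous[OF Cc_nonnegD(1)[OF p] Cc_imp_continuous[OF Cc_nonnegD(1)[OF hCc]]]
          Cc_nonnegD(2)[OF p] Cc_nonnegD(2)[OF hCc] by auto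
      \<comment> \<open>Since \<open>q = (p + \<eta>) * h\<close>, replacing \<open>q\<close> by
        \<open>p * h\<close> loses \<open>\<eta> * h\<close>, and \<open>F\<close> is at least 1
        wherever \<open>h\<close> is nonzero.\<close>
      have le: "q x \<le> p x * h x + \<eta> * F x" for x
      proof -
        have "q x = p x * h x + \<eta> * h x"
        proof -
          have "(p x + \<eta>) * h x = q x"
            using den[of x] by (simp add: h)
          then show ?thesis
            by (simp add: distrib_right)
        qed
        moreover have "h x \<le> F x"
        proof (cases "x \<in> K")
          case True
          have "h x \<le> 1"
            using den[of x] q(2)[of x] \<eta>(1) by (simp add: h field_simps)
          with us(2) True show ?thesis by (fastforce simp: F_def)
        next
          case False
          then have "q x = 0"
            using K(2) q Cc_nonnegD(2)[OF q(1), of x] by (metis antisym)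
          then show ?thesis
            using Cc_nonnegD(2)[OF F] by (simp add: h)
        qed
        ultimately show ?thesis using \<eta>(1) by simp
      qed
      have "cov q \<phi> \<le> cov (\<lambda>x. p x * h x + \<eta> * F x) \<phi>"
        using \<eta>(1) le by (intro cov_mono[OF \<phi>] Cc_nonneg_add Cc_nonneg_cmult pCc F) auto
      also have "\<dots> \<le> cov (\<lambda>x. p x * h x) \<phi> + cov (\<lambda>x. \<eta> * F x) \<phi>"
        using \<eta>(1) by (intro cov_add[OF \<phi>] Cc_nonneg_cmult pCc F) auto
      also have "cov (\<lambda>x. \<eta> * F x) \<phi> \<le> \<eta> * cov F \<phi>"
        using \<eta>(1) by (intro cov_cmult_le[OF \<phi>] F) auto
      finally show ?thesis by simp
    qed
    note this[of f hf] this[of g hg]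
    moreover have "cov F \<phi> \<le> cov F f0 * cov f0 \<phi>" "cov p \<phi> \<le> cov p f0 * cov f0 \<phi>"
      using cov_trans[OF \<phi> _ f0] F p by auto
    then have "\<eta> * cov F \<phi> \<le> \<eta> * (cov F f0 * cov f0 \<phi>)" "\<epsilon> * cov p \<phi> \<le> \<epsilon> * (cov p f0 * cov f0 \<phi>)"
      using \<eta>(1) \<epsilon>(1) by auto
    moreover have "2 * (\<eta> * cov F f0) * cov f0 \<phi> \<le> e / 2 * cov f0 \<phi>"
      "2 * (\<epsilon> * cov p f0) * cov f0 \<phi> \<le> e / 2 * cov f0 \<phi>"
      using \<eta>(2) \<epsilon>(2) cov_nonneg[OF \<phi> f0(1)] by (auto intro!: mult_right_mono simp del: times_divide_eq_left)
    ultimately have "cov f \<phi> + cov g \<phi> \<le> cov p \<phi> + e * cov f0 \<phi>"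
      using f g Cc_nonnegD(2)[OF f] Cc_nonnegD(2)[OF g] by (auto simp: p_def hf_def hg_def fun_eq_iff algebra_simps)
    then show "cov f \<phi> + cov g \<phi> \<le> cov (\<lambda>x. f x + g x) \<phi> + e * cov f0 \<phi>"
      by (simp add: p_def[abs_def])
  qed (use V W in auto)
qed

text \<open>Normalised covering numbers are points of a product of compact intervals, so Tychonoff
  yields a cluster point as \<open>\<phi>\<close> concentrates at 0; there
  \<open>approx_additive\<close> becomes exact. The product has a factor for each function, and a
  cluster point need not be the limit of a subsequence, which is why limits are taken along a
  filter.\<close>

theorem ex_right_invariant_functional:
  obtains I :: "('g \<Rightarrow> real) \<Rightarrow> real" where
    "\<And>f g. f \<in> Cc_nonneg \<Longrightarrow> g \<in> Cc_nonneg \<Longrightarrow> I (\<lambda>x. f x + g x) = I f + I g"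
    "\<And>f c. f \<in> Cc_nonneg \<Longrightarrow> 0 \<le> c \<Longrightarrow> I (\<lambda>x. c * f x) = c * I f"
    "\<And>f t. f \<in> Cc_nonneg \<Longrightarrow> I (\<lambda>x. f (x + t)) = I f"
    "\<And>f. f \<in> Cc_nonneg \<Longrightarrow> 0 \<le> I f"
    "\<And>f x. f \<in> Cc_nonneg \<Longrightarrow> 0 < f x \<Longrightarrow> 0 < I f"
proof -
  obtain f0 :: "'g \<Rightarrow> real" where f0: "f0 \<in> Cc_nonneg" "0 < f0 0"
    using ex_bump[of UNIV] by auto
  obtain A where A: "\<And>i. open (A i)" "\<And>i. (0::'g) \<in> A i"
      "\<And>S. open S \<Longrightarrow> 0 \<in> S \<Longrightarrow> eventually (\<lambda>i. A i \<subseteq> S) sequentially"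
    by (rule countable_basis_at_decseq[of "0::'g"]) blast
  have "\<forall>n. \<exists>\<phi>::'g \<Rightarrow> real. \<phi> \<in> Cc_nonneg \<and> 0 < \<phi> 0 \<and> (\<forall>x. x \<notin> A n \<longrightarrow> \<phi> x = 0)"
    using ex_bump[OF A(1,2)] by blast
  then obtain \<phi> :: "nat \<Rightarrow> 'g \<Rightarrow> real"
    where \<phi>: "\<And>n. \<phi> n \<in> Cc_nonneg" "\<And>n. 0 < \<phi> n 0" "\<And>n x. x \<notin> A n \<Longrightarrow> \<phi> n x = 0"
    by metis
  have cov0: "0 < cov f0 (\<phi> n)" for n
    using cov_pos[OF \<phi>(1,2) f0] .
  \<comment> \<open>The value 0 outside the cone \<open>Cc_nonneg\<close> keeps every coordinate in
    a bounded interval, with \<open>B f = 0\<close> there.\<close>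
  define J where "J n f = (if f \<in> Cc_nonneg then cov f (\<phi> n) / cov f0 (\<phi> n) else 0)" for n f
  define B where "B f = (if f \<in> Cc_nonneg then cov f f0 else 0)" for f
  have J_bounds: "J n f \<in> {0..B f}" for n f
    using cov_trans[OF \<phi>(1,2) _ f0] cov_nonneg[OF \<phi>(1,2), of f n] cov0[of n]
    by (auto simp: J_def B_def field_simps)
  have "compact (PiE UNIV (\<lambda>f. {0..B f}))"
    using compactin_PiE[of "\<lambda>f. euclidean" UNIV "\<lambda>f. {0..B f}"]
    by (simp add: euclidean_product_topology)
  moreover have "filtermap J sequentially \<noteq> bot"
    by (simp add: filtermap_bot_iff)
  moreover have "eventually (\<lambda>I. I \<in> PiE UNIV (\<lambda>f. {0..B f})) (filtermap J sequentially)"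
    using J_bounds by (simp add: eventually_filtermap PiE_iff)
  ultimately obtain I where I: "inf (nhds I) (filtermap J sequentially) \<noteq> bot"
    unfolding compact_filter by blast
  \<comment> \<open>Along \<open>F\<close>, which refines \<open>sequentially\<close>, the functionals converge to their cluster point.\<close>
  define F where "F = inf (filtercomap J (nhds I)) sequentially"
  have F: "F \<noteq> bot"
  proof
    assume "F = bot"
    then have "eventually (\<lambda>n. False) F" by simp
    then obtain P Q where PQ: "eventually P (filtercomap J (nhds I))" "eventually Q sequentially"
        "\<And>n. P n \<and> Q n \<Longrightarrow> False"
      unfolding F_def eventually_inf by blast
    then obtain R where R: "eventually R (nhds I)" "\<And>n. R (J n) \<Longrightarrow> P n"
      unfolding eventually_filtercomap by blast
    have "eventually (\<lambda>n. \<not> R (J n)) sequentially"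
      using PQ(2) by (rule eventually_mono) (use PQ(3) R(2) in blast)
    then have "eventually (\<lambda>L. \<not> R L) (filtermap J sequentially)"
      by (simp add: eventually_filtermap)
    with R(1) have "eventually (\<lambda>L. False) (inf (nhds I) (filtermap J sequentially))"
      unfolding eventually_inf by blast
    with I show False by (simp add: eventually_False)
  qed
  have F_le: "eventually P F" if "eventually P sequentially" for P
    using that unfolding F_def by (meson filter_leD inf_le2)
  have "filterlim J (nhds I) F"
    unfolding F_def by (metis filterlim_filtercomap filterlim_mono inf_le1 order_refl)
  then have lim: "((\<lambda>n. J n f) \<longlongrightarrow> I f) F" for f
    by (rule continuous_on_tendsto_compose[OF continuous_on_product_coordinates]) simp_all
  show ?thesis
  proof (rule that)
    fix f g :: "'g \<Rightarrow> real" assume f: "f \<in> Cc_nonneg" and g: "g \<in> Cc_nonneg"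
    note fg = Cc_nonneg_add[OF f g]
    have "J n (\<lambda>x. f x + g x) \<le> J n f + J n g" for n
      using cov_add[OF \<phi>(1,2) f g, of n] cov0[of n] f g fg by (simp add: J_def divide_simps)
    then have "I (\<lambda>x. f x + g x) \<le> I f + I g"
      by (intro tendsto_le[OF F tendsto_add[OF lim lim] lim]) simp
    moreover have "I f + I g \<le> I (\<lambda>x. f x + g x) + e" if "0 < e" for e
    proof -
      obtain V where V: "open V" "(0::'g) \<in> V"
        "\<And>\<phi>. \<phi> \<in> Cc_nonneg \<Longrightarrow> 0 < \<phi> 0 \<Longrightarrow> (\<And>x. x \<notin> V \<Longrightarrow> \<phi> x = 0) \<Longrightarrow>
          cov f \<phi> + cov g \<phi> \<le> cov (\<lambda>x. f x + g x) \<phi> + e * cov f0 \<phi>"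
        using approx_additive[OF f g f0 \<open>0 < e\<close>] by metis
      have "J n f + J n g \<le> J n (\<lambda>x. f x + g x) + e" if "A n \<subseteq> V" for n
      proof -
        have "cov f (\<phi> n) + cov g (\<phi> n) \<le> cov (\<lambda>x. f x + g x) (\<phi> n) + e * cov f0 (\<phi> n)"
          using that \<phi>(3) by (intro V(3) \<phi>(1,2)) blast
        then show ?thesis
          using cov0[of n] f g fg by (simp add: J_def divide_simps)
      qed
      then have "eventually (\<lambda>n. J n f + J n g \<le> J n (\<lambda>x. f x + g x) + e) F"
        using A(3)[OF V(1,2)] by (intro F_le) (auto elim: eventually_mono)
      then show ?thesis
        by (intro tendsto_le[OF F tendsto_add[OF lim tendsto_const] tendsto_add[OF lim lim]])
    qed
    then have "I f + I g \<le> I (\<lambda>x. f x + g x)"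
      by (rule field_le_epsilon)
    ultimately show "I (\<lambda>x. f x + g x) = I f + I g" by simp
  next
    fix f :: "'g \<Rightarrow> real" and c :: real assume f: "f \<in> Cc_nonneg" and c: "0 \<le> c"
    have "J n (\<lambda>x. c * f x) = c * J n f" for n
      using cov_cmult[OF \<phi>(1,2) f c] f Cc_nonneg_cmult[OF f c] by (simp add: J_def)
    then show "I (\<lambda>x. c * f x) = c * I f"
      using tendsto_unique[OF F lim[of "\<lambda>x. c * f x"]] tendsto_mult_left[OF lim[of f], of c] by simp
  next
    fix f :: "'g \<Rightarrow> real" and t assume f: "f \<in> Cc_nonneg"
    have "J n (\<lambda>x. f (x + t)) = J n f" for n
      using cov_translate[OF \<phi>(1,2) f] f Cc_nonneg_translate[OF f] by (simp add: J_def)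
    then show "I (\<lambda>x. f (x + t)) = I f"
      using tendsto_unique[OF F lim[of "\<lambda>x. f (x + t)"]] lim[of f] by simp
  next
    fix f :: "'g \<Rightarrow> real"
    show "0 \<le> I f"
      using J_bounds by (intro tendsto_lowerbound[OF lim _ F]) simp
  next
    fix f :: "'g \<Rightarrow> real" and x assume f: "f \<in> Cc_nonneg" and x: "0 < f x"
    \<comment> \<open>Translating the positive value to 0 allows \<open>h\<close> to be the
      intermediate function in \<open>cov_trans\<close>; the resulting bound
      \<open>1 / cov f0 h\<close> does not depend on \<open>n\<close> and survives the
      limit.\<close>
    define h where "h y = f (y + x)" for y
    have h: "h \<in> Cc_nonneg" "0 < h 0"
      using Cc_nonneg_translate[OF f] x by (auto simp: h_def[abs_def])
    have pos: "0 < cov f0 h"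
      using cov_pos[OF h f0] .
    have "1 / cov f0 h \<le> J n f" for n
    proof -
      have "cov f0 (\<phi> n) \<le> cov f0 h * cov h (\<phi> n)"
        by (rule cov_trans[OF \<phi>(1,2) f0(1) h])
      moreover have "cov h (\<phi> n) = cov f (\<phi> n)"
        unfolding h_def using cov_translate[OF \<phi>(1,2) f] .
      ultimately show ?thesis
        using pos cov0[of n] f by (simp add: J_def field_simps)
    qed
    then have "1 / cov f0 h \<le> I f"
      by (intro tendsto_lowerbound[OF lim _ F]) simp
    then show "0 < I f"
      using pos by (smt (verit) divide_pos_pos)
  qed
qed

end

section \<open>Extension to a linear positive functional\<close>

locale positive_functional =
  fixes J :: "('g::topological_space \<Rightarrow> real) \<Rightarrow> real"
  assumes add: "f \<in> Cc \<Longrightarrow> g \<in> Cc \<Longrightarrow> J (\<lambda>x. f x + g x) = J f + J g"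
    and cmult: "f \<in> Cc \<Longrightarrow> J (\<lambda>x. c * f x) = c * J f"
    and nonneg: "f \<in> Cc_nonneg \<Longrightarrow> 0 \<le> J f"
begin

lemma diff: "f \<in> Cc \<Longrightarrow> g \<in> Cc \<Longrightarrow> J (\<lambda>x. f x - g x) = J f - J g"
  using add[of f "\<lambda>x. -1 * g x"] cmult[of g "-1"] Cc_cmult[of g "-1"] by simp

lemma mono: "f \<in> Cc \<Longrightarrow> g \<in> Cc \<Longrightarrow> (\<And>x. f x \<le> g x) \<Longrightarrow> J f \<le> J g"
  using nonneg[of "\<lambda>x. g x - f x"] diff[of g f] Cc_diff[of g f] by (simp add: Cc_nonneg_def)

text \<open>Constants are in general not compactly supported, so a uniform bound is stated as a
  multiple of a majorant \<open>F\<close> in \<open>Cc\<close>.\<close>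

lemma abs_le:
  assumes "f \<in> Cc" "F \<in> Cc" "\<And>x. \<bar>f x\<bar> \<le> c * F x"
  shows "\<bar>J f\<bar> \<le> c * J F"
proof -
  have "- (c * F x) \<le> f x" "f x \<le> c * F x" for x
    using assms(3)[of x] by (auto simp: abs_le_iff)
  then have "J (\<lambda>x. - c * F x) \<le> J f" "J f \<le> J (\<lambda>x. c * F x)"
    by (intro mono Cc_cmult assms; simp)+
  then show ?thesis
    using cmult[OF assms(2), of c] cmult[OF assms(2), of "- c"] by (simp add: abs_le_iff)
qed

end

lemma (in locally_compact_group) ex_haar_functional:
  obtains J :: "('g \<Rightarrow> real) \<Rightarrow> real" where "positive_functional J"
    "\<And>f t. f \<in> Cc \<Longrightarrow> J (\<lambda>x. f (x + t)) = J f"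
    "\<And>f x. f \<in> Cc_nonneg \<Longrightarrow> 0 < f x \<Longrightarrow> 0 < J f"
proof -
  obtain I :: "('g \<Rightarrow> real) \<Rightarrow> real" where
    I_add: "\<And>f g. f \<in> Cc_nonneg \<Longrightarrow> g \<in> Cc_nonneg \<Longrightarrow> I (\<lambda>x. f x + g x) = I f + I g" and
    I_cmult: "\<And>f c. f \<in> Cc_nonneg \<Longrightarrow> 0 \<le> c \<Longrightarrow> I (\<lambda>x. c * f x) = c * I f" and
    I_translate: "\<And>f t. f \<in> Cc_nonneg \<Longrightarrow> I (\<lambda>x. f (x + t)) = I f" and
    I_nonneg: "\<And>f. f \<in> Cc_nonneg \<Longrightarrow> 0 \<le> I f" and
    I_pos: "\<And>f x. f \<in> Cc_nonneg \<Longrightarrow> 0 < f x \<Longrightarrow> 0 < I f"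
    by (rule ex_right_invariant_functional) blast
  define J where "J f = I (\<lambda>x. max (f x) 0) - I (\<lambda>x. max (- f x) 0)" for f
  have pos: "(\<lambda>x. max (f x) 0) \<in> Cc_nonneg" "(\<lambda>x. max (- f x) 0) \<in> Cc_nonneg" if "f \<in> Cc" for f :: "'g \<Rightarrow> real"
    using pos_part_Cc_nonneg[OF that] pos_part_Cc_nonneg[OF Cc_cmult[OF that, of "-1"]] by simp_all
  \<comment> \<open>Any decomposition into nonnegative functions gives the same value, because
    \<open>max f 0 + b = a + max (- f) 0\<close>. Linearity then follows without splitting the
    positive part of a sum.\<close>
  have J_eq: "J f = I a - I b"
    if "f \<in> Cc" "a \<in> Cc_nonneg" "b \<in> Cc_nonneg" "\<And>x. f x = a x - b x" for f a b
  proof -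
    have "(\<lambda>x. max (f x) 0 + b x) = (\<lambda>x. a x + max (- f x) 0)"
      by (auto simp: that(4) max_def)
    then have "I (\<lambda>x. max (f x) 0) + I b = I a + I (\<lambda>x. max (- f x) 0)"
      using I_add[OF pos(1)[OF that(1)] that(3)] I_add[OF that(2) pos(2)[OF that(1)]] by metis
    then show ?thesis by (simp add: J_def)
  qed
  have J_nonneg_eq: "J f = I f" if "f \<in> Cc_nonneg" for f
  proof -
    have "I (\<lambda>x. 0) = 0" using I_cmult[OF Cc_nonneg_zero, of 0] by simp
    then show ?thesis
      using J_eq[OF Cc_nonnegD(1)[OF that] that Cc_nonneg_zero] by simp
  qed
  show ?thesis
  proof (rule that)
    show "positive_functional J"
    proof
      fix f g :: "'g \<Rightarrow> real" assume f: "f \<in> Cc" and g: "g \<in> Cc"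
      show "J (\<lambda>x. f x + g x) = J f + J g"
      proof -
        have "J (\<lambda>x. f x + g x)
          = I (\<lambda>x. max (f x) 0 + max (g x) 0) - I (\<lambda>x. max (- f x) 0 + max (- g x) 0)"
          by (intro J_eq Cc_add f g Cc_nonneg_add pos) (simp add: max_def)
        then show ?thesis
          using I_add[OF pos(1)[OF f] pos(1)[OF g]] I_add[OF pos(2)[OF f] pos(2)[OF g]]
          by (simp add: J_def)
      qed
    next
      fix f :: "'g \<Rightarrow> real" and c assume f: "f \<in> Cc"
      show "J (\<lambda>x. c * f x) = c * J f"
      proof (cases "0 \<le> c")
        case True
        have "J (\<lambda>x. c * f x) = I (\<lambda>x. c * max (f x) 0) - I (\<lambda>x. c * max (- f x) 0)"
          by (intro J_eq Cc_cmult f Cc_nonneg_cmult pos True) (simp add: max_def)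
        then show ?thesis
          using I_cmult[OF pos(1)[OF f] True] I_cmult[OF pos(2)[OF f] True]
          by (simp add: J_def algebra_simps)
      next
        case False
        then have c: "0 \<le> - c" by simp
        have "J (\<lambda>x. c * f x) = I (\<lambda>x. - c * max (- f x) 0) - I (\<lambda>x. - c * max (f x) 0)"
          by (intro J_eq Cc_cmult f Cc_nonneg_cmult pos c) (simp add: max_def)
        then show ?thesis
          using I_cmult[OF pos(1)[OF f] c] I_cmult[OF pos(2)[OF f] c]
          by (simp add: J_def algebra_simps)
      qed
    qed (simp add: J_nonneg_eq I_nonneg)
    show "J (\<lambda>x. f (x + t)) = J f" if "f \<in> Cc" for f t
      using I_translate[OF pos(1)[OF that], of t] I_translate[OF pos(2)[OF that], of t]
      by (simp add: J_def)
    show "0 < J f" if "f \<in> Cc_nonneg" "0 < f x" for f x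
      using that by (simp add: J_nonneg_eq I_pos)
  qed
qed

section \<open>Integrals depending smoothly on a parameter\<close>

lemma Cc_sum: "(\<And>i. i \<in> I \<Longrightarrow> f i \<in> Cc) \<Longrightarrow> (\<lambda>x. \<Sum>i\<in>I. f i x) \<in> Cc"
  by (induction I rule: infinite_finite_induct) (auto simp: Cc_zero intro: Cc_add)

lemma (in positive_functional) sum:
  assumes "\<And>i. i \<in> I \<Longrightarrow> f i \<in> Cc"
  shows "J (\<lambda>x. \<Sum>i\<in>I. f i x) = (\<Sum>i\<in>I. J (f i))"
  using assms
proof (induction I rule: infinite_finite_induct)
  case (insert i I)
  have "J (\<lambda>x. f i x + (\<Sum>i\<in>I. f i x)) = J (f i) + J (\<lambda>x. \<Sum>i\<in>I. f i x)"
    using insert.prems by (intro add Cc_sum) auto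
  with insert show ?case by simp
qed (use cmult[OF Cc_zero, of 0] in simp_all)

text \<open>The homeomorphism supplies some inverse; injectivity identifies it on the image with
  \<open>inv_into U \<phi>\<close>, through which smoothness is defined.\<close>

lemma is_chartD:
  assumes "is_chart U \<phi>"
  shows "open U" "open (\<phi> ` U)" "inj_on \<phi> U" "continuous_on U \<phi>" "continuous_on (\<phi> ` U) (inv_into U \<phi>)"
proof -
  obtain \<psi> where \<psi>: "homeomorphism U (\<phi> ` U) \<phi> \<psi>"
    using assms by (auto simp: is_chart_def)
  then show inj: "inj_on \<phi> U"
    by (metis homeomorphism_def inj_on_inverseI)
  have "inv_into U \<phi> y = \<psi> y" if "y \<in> \<phi> ` U" for y
    using \<psi> that inj by (auto simp: homeomorphism_def)
  then show "continuous_on (\<phi> ` U) (inv_into U \<phi>)"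
    using \<psi> by (simp add: homeomorphism_def cong: continuous_on_cong)
qed (use assms in \<open>auto simp: is_chart_def homeomorphism_def\<close>)

lemma smooth_manifold_is_chart: "smooth_manifold A \<Longrightarrow> (U, \<phi>) \<in> A \<Longrightarrow> is_chart U \<phi>"
  by (auto simp: smooth_manifold_def)

lemma smooth_manifold_ex_chart:
  assumes "smooth_manifold A"
  obtains U \<phi> where "(U, \<phi>) \<in> A" "x \<in> U"
proof -
  have "x \<in> (\<Union>(U, \<phi>)\<in>A. U)"
    using assms by (simp add: smooth_manifold_def)
  with that show ?thesis by auto
qed

text \<open>The setting for differentiation under \<open>J\<close>: the parameter ranges over
  \<open>Z\<close>, the integrands share the compact set \<open>K\<close>, and \<open>F\<close> is
  the majorant through which estimates on \<open>K\<close> reach \<open>J\<close>.\<close>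

locale smooth_family = positive_functional J
  for J :: "('g::{t2_space, second_countable_topology} \<Rightarrow> real) \<Rightarrow> real" +
  fixes A :: "('g, 'd::findim_inner) atlas" and Z :: "'e::findim_inner set" and K :: "'g set"
    and F :: "'g \<Rightarrow> real"
  assumes manifold: "smooth_manifold A" and open_Z: "open Z" and compact_K: "compact K"
    and F: "F \<in> Cc_nonneg" "\<And>g. g \<in> K \<Longrightarrow> 1 \<le> F g"
begin

text \<open>Smoothness is joint in the group element and the parameter, so that parameter
  derivatives form a family again.\<close>

definition family :: "('g \<Rightarrow> 'e \<Rightarrow> real) \<Rightarrow> bool" where
  "family H \<longleftrightarrow> (\<forall>g z. z \<in> Z \<longrightarrow> g \<notin> K \<longrightarrow> H g z = 0) \<and>
    (\<forall>(W, \<kappa>)\<in>A. smooth_on (\<kappa> ` W \<times> Z) (\<lambda>(a, z). H (inv_into W \<kappa> a) z))"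

definition partial :: "('g \<Rightarrow> 'e \<Rightarrow> real) \<Rightarrow> 'e \<Rightarrow> 'g \<Rightarrow> 'e \<Rightarrow> real" where
  "partial H v g z = frechet_derivative (H g) (at z) v"

lemma family_zero: "family H \<Longrightarrow> z \<in> Z \<Longrightarrow> g \<notin> K \<Longrightarrow> H g z = 0"
  by (simp add: family_def)

lemma family_smooth:
  "family H \<Longrightarrow> (W, \<kappa>) \<in> A \<Longrightarrow> smooth_on (\<kappa> ` W \<times> Z) (\<lambda>(a, z). H (inv_into W \<kappa> a) z)"
  by (auto simp: family_def)

lemma family_continuous:
  assumes "family H"
  shows "continuous_on (Z \<times> UNIV) (\<lambda>(z, g). H g z)"
proof (rule continuous_at_imp_continuous_on, rule ballI)
  fix p :: "'e \<times> 'g" assume "p \<in> Z \<times> UNIV"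
  then obtain z g where p: "p = (z, g)" "z \<in> Z" by auto
  obtain W \<kappa> where W: "(W, \<kappa>) \<in> A" "g \<in> W"
    using smooth_manifold_ex_chart[OF manifold] by blast
  note chart = is_chartD[OF smooth_manifold_is_chart[OF manifold W(1)]]
  have cont: "continuous_on (Z \<times> W) (\<lambda>p. (\<kappa> (snd p), fst p))"
    by (intro continuous_intros continuous_on_compose2[OF chart(4)]) auto
  have "continuous_on (Z \<times> W) (\<lambda>p. (\<lambda>(a, z). H (inv_into W \<kappa> a) z) (\<kappa> (snd p), fst p))"
    by (rule continuous_on_compose2[OF smooth_on_imp_continuous_on[OF family_smooth[OF assms W(1)]] cont]) auto
  then have "continuous_on (Z \<times> W) (\<lambda>(z, g). H g z)"
    by (rule continuous_on_eq) (auto simp: inv_into_f_f[OF chart(3)])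
  moreover have "open (Z \<times> W)"
    using open_Z chart(1) by (rule open_Times)
  ultimately show "isCont (\<lambda>(z, g). H g z) p"
    using p W(2) by (simp add: continuous_on_eq_continuous_at)
qed

lemma family_Cc:
  assumes "family H" "z \<in> Z"
  shows "(\<lambda>g. H g z) \<in> Cc"
proof -
  have "continuous_on UNIV (\<lambda>g. (\<lambda>(z, g). H g z) (z, g))"
    using assms(2) by (intro continuous_on_compose2[OF family_continuous[OF assms(1)]] continuous_intros) auto
  then show ?thesis
    using family_zero[OF assms] compact_K by (auto simp: Cc_def)
qed

text \<open>The tube lemma makes continuity in the parameter uniform over \<open>K\<close>, and off
  \<open>K\<close> both values vanish. The bound carries the factor \<open>F g\<close> so that
  \<open>abs_le\<close> can use it.\<close>

lemma family_uniform:
  assumes "family H" "z0 \<in> Z" "0 < e"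
  obtains d where "0 < d" "ball z0 d \<subseteq> Z" "\<And>z g. z \<in> ball z0 d \<Longrightarrow> \<bar>H g z - H g z0\<bar> \<le> e * F g"
proof -
  let ?h = "\<lambda>p. \<bar>H (snd p) (fst p) - H (snd p) z0\<bar>"
  have "continuous_on (Z \<times> UNIV) (\<lambda>p. (\<lambda>(z, g). H g z) (z0, snd p))"
    using assms(2) by (intro continuous_on_compose2[OF family_continuous[OF assms(1)]] continuous_intros) auto
  then have "continuous_on (Z \<times> UNIV) ?h"
    using family_continuous[OF assms(1)] by (intro continuous_intros) (simp_all add: case_prod_beta)
  moreover have "open (Z \<times> (UNIV :: 'g set))"
    using open_Z by (intro open_Times) auto
  ultimately have op: "open ((Z \<times> UNIV) \<inter> ?h -` {..<e})"
    by (intro continuous_open_preimage) auto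
  have "{z0} \<times> K \<subseteq> (Z \<times> UNIV) \<inter> ?h -` {..<e}"
    using assms(2,3) by auto
  from Elementary_Topology.tube_lemma[OF compact_K op this]
  obtain X where X: "z0 \<in> X" "open X" "X \<times> K \<subseteq> (Z \<times> UNIV) \<inter> ?h -` {..<e}"
    by (elim exE conjE)
  obtain d where d: "0 < d" "ball z0 d \<subseteq> X \<inter> Z"
    using X(1,2) open_Z assms(2) by (meson IntI openE open_Int)
  show ?thesis
  proof
    fix z g assume z: "z \<in> ball z0 d"
    show "\<bar>H g z - H g z0\<bar> \<le> e * F g"
    proof (cases "g \<in> K")
      case True
      then have "(z, g) \<in> (Z \<times> UNIV) \<inter> ?h -` {..<e}"
        using X(3) z d(2) by blast
      then have "\<bar>H g z - H g z0\<bar> \<le> e * 1"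
        by auto
      also have "\<dots> \<le> e * F g"
        using F(2)[OF True] assms(3) by (intro mult_left_mono) auto
      finally show ?thesis .
    next
      case False
      then show ?thesis
        using family_zero[OF assms(1)] assms(2,3) z d(2) Cc_nonnegD(2)[OF F(1), of g] by auto
    qed
  qed (use d in auto)
qed

text \<open>In a chart, \<open>partial H v\<close> is the joint derivative in the direction
  \<open>(0, v)\<close> and so inherits joint smoothness. Off \<open>K\<close> the function vanishes
  on all of the open set \<open>Z\<close>, hence so does its derivative.\<close>

lemma family_partial:
  assumes H: "family H"
  shows family_has_derivative: "z \<in> Z \<Longrightarrow> (H g has_derivative (\<lambda>v. partial H v g z)) (at z)"
    and "family (partial H v)"
proof -
  have deriv: "(H (inv_into W \<kappa> a) has_derivative
      (\<lambda>v. frechet_derivative (\<lambda>(a, z). H (inv_into W \<kappa> a) z) (at (a, z)) (0, v))) (at z)"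
    if W: "(W, \<kappa>) \<in> A" and a: "a \<in> \<kappa> ` W" and z: "z \<in> Z" for W \<kappa> a z
  proof -
    have "((\<lambda>z. (a, z)) has_derivative (\<lambda>v. (0, v))) (at z)"
      by (auto intro!: derivative_eq_intros)
    moreover have "((\<lambda>(a, z). H (inv_into W \<kappa> a) z) has_derivative
        frechet_derivative (\<lambda>(a, z). H (inv_into W \<kappa> a) z) (at (a, z))) (at (a, z))"
      using a z by (intro smooth_on_has_derivative[OF family_smooth[OF H W]]) auto
    ultimately have "((\<lambda>z. (\<lambda>(a, z). H (inv_into W \<kappa> a) z) (a, z)) has_derivative
        (\<lambda>v. frechet_derivative (\<lambda>(a, z). H (inv_into W \<kappa> a) z) (at (a, z)) (0, v))) (at z)"
      by (rule has_derivative_compose)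
    then show ?thesis by simp
  qed
  show "(H g has_derivative (\<lambda>v. partial H v g z)) (at z)" if z: "z \<in> Z" for g z
  proof -
    obtain W \<kappa> where W: "(W, \<kappa>) \<in> A" "g \<in> W"
      using smooth_manifold_ex_chart[OF manifold] by blast
    have "inv_into W \<kappa> (\<kappa> g) = g"
      using is_chartD(3)[OF smooth_manifold_is_chart[OF manifold W(1)]] W(2) by simp
    then have "H g differentiable (at z)"
      using deriv[OF W(1) imageI[OF W(2)] z] by (auto simp: differentiable_def)
    then show ?thesis
      by (simp add: partial_def frechet_derivative_works)
  qed
  show "family (partial H v)"
    unfolding family_def
  proof (intro conjI allI impI ballI, goal_cases)
    case (1 g z)
    then have "frechet_derivative (H g) (at z) = frechet_derivative (\<lambda>z. 0) (at z)"
      using family_zero[OF H] by (intro frechet_derivative_cong_open[OF open_Z]) auto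
    then show ?case
      by (simp add: partial_def frechet_derivative_const)
  next
    case (2 p)
    obtain W \<kappa> where p: "p = (W, \<kappa>)" by (cases p)
    with 2 have W: "(W, \<kappa>) \<in> A" by simp
    let ?h = "\<lambda>(a, z). H (inv_into W \<kappa> a) z"
    have op: "open (\<kappa> ` W \<times> Z)"
      using is_chartD(2)[OF smooth_manifold_is_chart[OF manifold W]] open_Z by (rule open_Times)
    have "frechet_derivative ?h (at q) (0, v) = (case q of (a, z) \<Rightarrow> partial H v (inv_into W \<kappa> a) z)"
      if "q \<in> \<kappa> ` W \<times> Z" for q
    proof -
      obtain a z where q: "q = (a, z)" "a \<in> \<kappa> ` W" "z \<in> Z"
        using \<open>q \<in> \<kappa> ` W \<times> Z\<close> by auto
      show ?thesis
        using frechet_derivative_at[OF deriv[OF W q(2,3)]] by (simp add: q(1) partial_def fun_eq_iff)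
    qed
    from smooth_on_cong[OF op this] have "smooth_on (\<kappa> ` W \<times> Z) (\<lambda>(a, z). partial H v (inv_into W \<kappa> a) z)"
      using smooth_on_frechet_derivative[OF family_smooth[OF H W], of "(0, v)"] by simp
    then show ?case by (simp add: p)
  qed
qed

text \<open>The mean value theorem on the segment from \<open>z0\<close> to \<open>z\<close> writes
  the remainder as a combination of increments of partial derivatives. These are small uniformly in
  \<open>g\<close> relative to \<open>F\<close>, and positivity carries the estimate over to
  \<open>J\<close>.\<close>

lemma integral_has_derivative:
  assumes H: "family H" and z0: "z0 \<in> Z"
    and B: "finite B" "\<And>x::'e. x = (\<Sum>b\<in>B. (x \<bullet> b / (b \<bullet> b)) *\<^sub>R b)"
  shows "((\<lambda>z. J (\<lambda>g. H g z)) has_derivative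
    (\<lambda>v. \<Sum>b\<in>B. (v \<bullet> b / (b \<bullet> b)) * J (\<lambda>g. partial H b g z0))) (at z0)"
  unfolding has_derivative_at_alt
proof (intro conjI allI impI)
  show "bounded_linear (\<lambda>v. \<Sum>b\<in>B. (v \<bullet> b / (b \<bullet> b)) * J (\<lambda>g. partial H b g z0))"
    by (intro bounded_linear_sum bounded_linear_mult_const
        bounded_linear_compose[OF bounded_linear_divide bounded_linear_inner_left])
  fix e :: real assume "0 < e"
  define C where "C = (\<Sum>b\<in>B. norm (b /\<^sub>R (b \<bullet> b)))"
  have C: "0 \<le> C" by (simp add: C_def sum_nonneg)
  have JF: "0 \<le> J F" using F(1) by (rule nonneg)
  \<comment> \<open>Chosen for the final bound \<open>C * e' * J F \<le> e\<close>; the sum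
    \<open>C\<close> bounds the coordinate functionals.\<close>
  define e' where "e' = e / (1 + C * J F)"
  have e': "0 < e'" "C * e' * J F \<le> e"
    using \<open>0 < e\<close> C JF by (auto simp: e'_def field_simps add_pos_nonneg)
  have "\<exists>d>0. ball z0 d \<subseteq> Z \<and> (\<forall>z\<in>ball z0 d. \<forall>g. \<bar>partial H b g z - partial H b g z0\<bar> \<le> e' * F g)" for b
    using family_uniform[OF family_partial(2)[OF H] z0 e'(1)] by metis
  then obtain d where d: "\<And>b. 0 < d b" "\<And>b. ball z0 (d b) \<subseteq> Z"
      "\<And>b z g. z \<in> ball z0 (d b) \<Longrightarrow> \<bar>partial H b g z - partial H b g z0\<bar> \<le> e' * F g"
    by metis
  \<comment> \<open>The radius for the direction 0 keeps the minimum over a nonempty set and the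
    ball inside \<open>Z\<close> even when \<open>B\<close> is empty.\<close>
  define \<delta> where "\<delta> = Min (insert (d 0) (d ` B))"
  have \<delta>: "0 < \<delta>" "\<delta> \<le> d 0" "\<And>b. b \<in> B \<Longrightarrow> \<delta> \<le> d b"
    using B(1) d(1) by (auto simp: \<delta>_def)
  have "norm (J (\<lambda>g. H g z) - J (\<lambda>g. H g z0) - (\<Sum>b\<in>B. ((z - z0) \<bullet> b / (b \<bullet> b)) * J (\<lambda>g. partial H b g z0)))
      \<le> e * norm (z - z0)" if z: "norm (z - z0) < \<delta>" for z
  proof -
    define c where "c b = (z - z0) \<bullet> b / (b \<bullet> b)" for b
    have seg: "z0 + t *\<^sub>R (z - z0) \<in> ball z0 \<delta>" if "0 \<le> t" "t \<le> 1" for t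
    proof -
      have "t * norm (z - z0) \<le> norm (z - z0)"
        using that by (simp add: mult_left_le_one_le)
      with z that show ?thesis by (simp add: dist_norm)
    qed
    have ball: "ball z0 \<delta> \<subseteq> Z"
      using \<delta>(2) d(2)[of 0] by auto
    have zZ: "z \<in> Z"
      using seg[of 1] ball by auto
    have pointwise: "\<bar>H g z - H g z0 - (\<Sum>b\<in>B. c b * partial H b g z0)\<bar> \<le> (C * e' * norm (z - z0)) * F g" for g
    proof -
      have "((\<lambda>t. H g (z0 + t *\<^sub>R (z - z0))) has_real_derivative
          partial H (z - z0) g (z0 + t *\<^sub>R (z - z0))) (at t)" if "0 \<le> t" "t \<le> 1" for t
      proof -
        have D: "(H g has_derivative (\<lambda>v. partial H v g (z0 + t *\<^sub>R (z - z0)))) (at (z0 + t *\<^sub>R (z - z0)))"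
          using seg[OF that] ball by (intro family_has_derivative[OF H]) auto
        have "((\<lambda>t. z0 + t *\<^sub>R (z - z0)) has_derivative (\<lambda>s. s *\<^sub>R (z - z0))) (at t)"
          by (auto intro!: derivative_eq_intros)
        from has_derivative_compose[OF this D]
        have "((\<lambda>t. H g (z0 + t *\<^sub>R (z - z0))) has_derivative
            (\<lambda>s. partial H (s *\<^sub>R (z - z0)) g (z0 + t *\<^sub>R (z - z0)))) (at t)" .
        moreover have "partial H (s *\<^sub>R (z - z0)) g (z0 + t *\<^sub>R (z - z0))
            = partial H (z - z0) g (z0 + t *\<^sub>R (z - z0)) * s" for s
          using linear_scale[OF has_derivative_linear[OF D]] by simp
        ultimately show ?thesis
          by (simp add: has_field_derivative_def)
      qed
      then obtain t where t: "0 < t" "t < 1"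
          "H g (z0 + 1 *\<^sub>R (z - z0)) - H g (z0 + 0 *\<^sub>R (z - z0))
            = (1 - 0) * partial H (z - z0) g (z0 + t *\<^sub>R (z - z0))"
        using MVT2[of 0 1 "\<lambda>t. H g (z0 + t *\<^sub>R (z - z0))"
            "\<lambda>t. partial H (z - z0) g (z0 + t *\<^sub>R (z - z0))"] by auto
      \<comment> \<open>The intermediate point depends on \<open>g\<close>; this is harmless because
        the increments are controlled on the whole ball.\<close>
      define \<xi> where "\<xi> = z0 + t *\<^sub>R (z - z0)"
      have \<xi>: "\<xi> \<in> ball z0 \<delta>"
        using seg t by (simp add: \<xi>_def)
      interpret D: linear "\<lambda>v. partial H v g \<xi>"
        using \<xi> ball by (intro has_derivative_linear[OF family_has_derivative[OF H]]) auto
      have "partial H (z - z0) g \<xi> = partial H (\<Sum>b\<in>B. c b *\<^sub>R b) g \<xi>"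
        unfolding c_def using B(2)[of "z - z0"] by simp
      then have "partial H (z - z0) g \<xi> = (\<Sum>b\<in>B. c b * partial H b g \<xi>)"
        by (simp add: D.sum D.scale)
      then have "H g z - H g z0 = (\<Sum>b\<in>B. c b * partial H b g \<xi>)"
        using t(3) by (simp add: \<xi>_def)
      then have "H g z - H g z0 - (\<Sum>b\<in>B. c b * partial H b g z0)
          = (\<Sum>b\<in>B. c b * (partial H b g \<xi> - partial H b g z0))"
        by (simp add: sum_subtractf right_diff_distrib)
      also have "\<bar>\<dots>\<bar> \<le> (\<Sum>b\<in>B. \<bar>c b * (partial H b g \<xi> - partial H b g z0)\<bar>)"
        by (rule sum_abs)
      also have "\<dots> \<le> (\<Sum>b\<in>B. (norm (z - z0) * norm (b /\<^sub>R (b \<bullet> b))) * (e' * F g))"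
        unfolding abs_mult
      proof (intro sum_mono mult_mono)
        fix b assume b: "b \<in> B"
        have "c b = (z - z0) \<bullet> (b /\<^sub>R (b \<bullet> b))"
          by (simp add: c_def divide_inverse mult.commute)
        then show "\<bar>c b\<bar> \<le> norm (z - z0) * norm (b /\<^sub>R (b \<bullet> b))"
          using Cauchy_Schwarz_ineq2 by metis
        show "\<bar>partial H b g \<xi> - partial H b g z0\<bar> \<le> e' * F g"
          using \<xi> \<delta>(3)[OF b] by (intro d(3)) auto
      qed auto
      also have "\<dots> = (C * e' * norm (z - z0)) * F g"
        by (simp add: C_def sum_distrib_left sum_distrib_right mult_ac)
      finally show ?thesis .
    qed
    have Cc: "(\<lambda>g. H g z) \<in> Cc" "(\<lambda>g. H g z0) \<in> Cc" "(\<lambda>g. c b * partial H b g z0) \<in> Cc"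
        "(\<lambda>g. \<Sum>b\<in>B. c b * partial H b g z0) \<in> Cc" for b
      by (intro Cc_sum Cc_cmult family_Cc H family_partial(2)[OF H] zZ z0)+
    have "J (\<lambda>g. \<Sum>b\<in>B. c b * partial H b g z0) = (\<Sum>b\<in>B. c b * J (\<lambda>g. partial H b g z0))"
      using Cc(3) by (simp add: sum cmult family_Cc family_partial(2)[OF H] z0)
    then have "J (\<lambda>g. H g z) - J (\<lambda>g. H g z0) - (\<Sum>b\<in>B. c b * J (\<lambda>g. partial H b g z0))
        = J (\<lambda>g. H g z - H g z0 - (\<Sum>b\<in>B. c b * partial H b g z0))"
      using diff[OF Cc_diff[OF Cc(1,2)] Cc(4)] diff[OF Cc(1,2)] by simp
    also have "\<bar>\<dots>\<bar> \<le> (C * e' * norm (z - z0)) * J F"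
      using pointwise by (intro abs_le Cc_diff Cc Cc_nonnegD(1)[OF F(1)])
    also have "\<dots> = C * e' * J F * norm (z - z0)"
      by simp
    also have "\<dots> \<le> e * norm (z - z0)"
      using e'(2) by (rule mult_right_mono) simp
    finally show ?thesis
      by (simp add: c_def)
  qed
  with \<delta>(1) show "\<exists>d>0. \<forall>z. norm (z - z0) < d \<longrightarrow>
      norm (J (\<lambda>g. H g z) - J (\<lambda>g. H g z0) - (\<Sum>b\<in>B. ((z - z0) \<bullet> b / (b \<bullet> b)) * J (\<lambda>g. partial H b g z0)))
      \<le> e * norm (z - z0)"
    by blast
qed

text \<open>Derivatives of the integral are combinations of integrals of families, so the induction
  on the order runs over all families at once.\<close>

theorem smooth_on_integral:
  assumes "family H"
  shows "smooth_on Z (\<lambda>z. J (\<lambda>g. H g z))"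
proof -
  obtain B :: "'e set" where B: "finite B" "\<And>x. x = (\<Sum>b\<in>B. (x \<bullet> b / (b \<bullet> b)) *\<^sub>R b)"
    using ex_orthogonal_expansion by blast
  have "Ck_on k Z (\<lambda>z. J (\<lambda>g. H g z))" for k
    using assms
  proof (induction k arbitrary: H)
    case 0
    then have "isCont (\<lambda>z. J (\<lambda>g. H g z)) z" if "z \<in> Z" for z
      using has_derivative_continuous[OF integral_has_derivative[OF 0 that B]] by simp
    then show ?case
      by (simp add: continuous_at_imp_continuous_on)
  next
    case (Suc k)
    show ?case
    proof (rule Ck_on_SucI[OF open_Z integral_has_derivative[OF Suc.prems _ B]])
      show "Ck_on k Z (\<lambda>z. \<Sum>b\<in>B. (v \<bullet> b / (b \<bullet> b)) * J (\<lambda>g. partial H b g z))" for v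
        by (intro Ck_on_sum Ck_on_mult Ck_on_const Suc.IH family_partial(2)[OF Suc.prems] open_Z)
    qed
  qed
  then show ?thesis by (simp add: smooth_on_def)
qed

end

section \<open>Invariant smooth functions\<close>

definition chart_bump :: "'m set \<Rightarrow> ('m \<Rightarrow> 'e::real_inner) \<Rightarrow> 'm \<Rightarrow> real \<Rightarrow> 'm \<Rightarrow> real" where
  "chart_bump U \<phi> x r y = (if y \<in> U then flat_exp 0 (r\<^sup>2 - (norm (\<phi> y - \<phi> x))\<^sup>2) else 0)"

text \<open>For large \<open>r\<close> the coordinate ball may leave the image of the chart, so
  compactness is carried as a separate hypothesis below.\<close>

definition chart_ball :: "'m set \<Rightarrow> ('m \<Rightarrow> 'e::real_normed_vector) \<Rightarrow> 'm \<Rightarrow> real \<Rightarrow> 'm set" where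
  "chart_ball U \<phi> x r = {y \<in> U. norm (\<phi> y - \<phi> x) \<le> r}"

lemma chart_bump_nonneg: "0 \<le> chart_bump U \<phi> x r y"
  by (simp add: chart_bump_def flat_exp_nonneg)

lemma chart_bump_pos: "x \<in> U \<Longrightarrow> 0 < r \<Longrightarrow> 0 < chart_bump U \<phi> x r x"
  by (simp add: chart_bump_def flat_exp_pos_iff)

lemma chart_bump_zero:
  assumes "y \<notin> chart_ball U \<phi> x r" "0 < r"
  shows "chart_bump U \<phi> x r y = 0"
proof (cases "y \<in> U")
  case True
  with assms have "r < norm (\<phi> y - \<phi> x)"
    by (simp add: chart_ball_def)
  then have "r\<^sup>2 \<le> (norm (\<phi> y - \<phi> x))\<^sup>2"
    using assms(2) by (intro power_mono) auto
  then show ?thesis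
    by (simp add: chart_bump_def flat_exp_def)
qed (simp add: chart_bump_def)

lemma ex_chart_ball:
  fixes A :: "('m::{t2_space, second_countable_topology}, 'e::findim_inner) atlas"
  assumes "smooth_manifold A" "open V" "x \<in> V"
  obtains U \<phi> r where "(U, \<phi>) \<in> A" "x \<in> U" "0 < r" "compact (chart_ball U \<phi> x r)" "chart_ball U \<phi> x r \<subseteq> V"
proof -
  obtain U \<phi> where U: "(U, \<phi>) \<in> A" "x \<in> U"
    using smooth_manifold_ex_chart[OF assms(1)] by blast
  note chart = is_chartD[OF smooth_manifold_is_chart[OF assms(1) U(1)]]
  have "open (\<phi> ` U \<inter> inv_into U \<phi> -` V)"
    using chart(5,2) assms(2) by (rule continuous_open_preimage)
  moreover have "\<phi> x \<in> \<phi> ` U \<inter> inv_into U \<phi> -` V"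
    using U(2) assms(3) chart(3) by simp
  ultimately obtain r where r: "0 < r" "cball (\<phi> x) r \<subseteq> \<phi> ` U \<inter> inv_into U \<phi> -` V"
    using open_contains_cball by blast
  have eq: "chart_ball U \<phi> x r = inv_into U \<phi> ` cball (\<phi> x) r"
  proof (intro equalityI subsetI)
    fix y assume "y \<in> chart_ball U \<phi> x r"
    then have "y = inv_into U \<phi> (\<phi> y)" "\<phi> y \<in> cball (\<phi> x) r"
      using chart(3) by (auto simp: chart_ball_def dist_norm norm_minus_commute)
    then show "y \<in> inv_into U \<phi> ` cball (\<phi> x) r" by blast
  next
    fix y assume "y \<in> inv_into U \<phi> ` cball (\<phi> x) r"
    then obtain z where z: "z \<in> cball (\<phi> x) r" "y = inv_into U \<phi> z" by blast
    then have "z \<in> \<phi> ` U" using r(2) by blast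
    with z show "y \<in> chart_ball U \<phi> x r"
      by (auto simp: chart_ball_def inv_into_into f_inv_into_f dist_norm norm_minus_commute)
  qed
  have "compact (chart_ball U \<phi> x r)"
    unfolding eq using r(2)
    by (intro compact_continuous_image continuous_on_subset[OF chart(5)] compact_cball_findim) blast
  moreover have "chart_ball U \<phi> x r \<subseteq> V"
    unfolding eq using r(2) by blast
  ultimately show ?thesis
    using that U r(1) by blast
qed

text \<open>Extension by zero is continuous because two open sets cover the manifold:
  \<open>U\<close>, and the complement of the chart ball, which is compact and hence closed in a
  Hausdorff space.\<close>

lemma chart_bump_Cc_nonneg:
  fixes \<phi> :: "'m::t2_space \<Rightarrow> 'e::findim_inner"
  assumes "is_chart U \<phi>" "compact (chart_ball U \<phi> x r)" "0 < r"
  shows "chart_bump U \<phi> x r \<in> Cc_nonneg"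
proof -
  note chart = is_chartD[OF assms(1)]
  have flat: "continuous_on UNIV (flat_exp 0)"
    using smooth_on_flat_exp by (rule smooth_on_imp_continuous_on)
  have "continuous_on U (\<lambda>y. flat_exp 0 (r\<^sup>2 - (norm (\<phi> y - \<phi> x))\<^sup>2))"
    by (rule continuous_on_compose2[OF flat]) (auto intro!: continuous_intros chart(4))
  then have U: "continuous_on U (chart_bump U \<phi> x r)"
    by (rule continuous_on_eq) (simp add: chart_bump_def)
  have "continuous_on (- chart_ball U \<phi> x r) (\<lambda>y. 0 :: real)"
    by simp
  then have "continuous_on (- chart_ball U \<phi> x r) (chart_bump U \<phi> x r)"
    by (rule continuous_on_eq) (simp add: chart_bump_zero[OF _ assms(3)])
  moreover have "open (- chart_ball U \<phi> x r)"
    using assms(2) by (simp add: compact_imp_closed open_Compl)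
  ultimately have "continuous_on (U \<union> - chart_ball U \<phi> x r) (chart_bump U \<phi> x r)"
    using U chart(1) by (intro continuous_on_open_Un)
  moreover have "U \<union> - chart_ball U \<phi> x r = UNIV"
    by (auto simp: chart_ball_def)
  ultimately show ?thesis
    using assms(2) chart_bump_zero[OF _ assms(3)] chart_bump_nonneg
    by (auto simp: Cc_nonneg_def Cc_def intro!: exI[of _ "chart_ball U \<phi> x r"])
qed

text \<open>The map \<open>P\<close> is general because the bump will be evaluated along the action,
  jointly in group and point coordinates.\<close>

lemma smooth_on_chart_bump:
  fixes \<phi> :: "'m::t2_space \<Rightarrow> 'e::findim_inner" and P :: "'s::real_normed_vector \<Rightarrow> 'm"
  assumes "is_chart U \<phi>" "compact (chart_ball U \<phi> x r)" "0 < r"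
    and "open S" "continuous_on S P" "smooth_on (S \<inter> P -` U) (\<lambda>s. \<phi> (P s))"
  shows "smooth_on S (\<lambda>s. chart_bump U \<phi> x r (P s))"
proof (rule smooth_on_local)
  fix s assume s: "s \<in> S"
  note chart = is_chartD[OF assms(1)]
  show "\<exists>T. open T \<and> s \<in> T \<and> smooth_on T (\<lambda>s. chart_bump U \<phi> x r (P s))"
  proof (cases "P s \<in> U")
    case True
    have op: "open (S \<inter> P -` U)"
      using assms(5,4) chart(1) by (rule continuous_open_preimage)
    have "smooth_on (S \<inter> P -` U) (\<lambda>s. flat_exp 0 (r\<^sup>2 - (norm (\<phi> (P s) - \<phi> x))\<^sup>2))"
      by (rule smooth_on_compose[OF op subset_UNIV assms(6) smooth_on_bump])
    then have "smooth_on (S \<inter> P -` U) (\<lambda>s. chart_bump U \<phi> x r (P s))"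
      by (subst smooth_on_cong[OF op]) (auto simp: chart_bump_def)
    with op s True show ?thesis by blast
  next
    case False
    have op: "open (S \<inter> P -` (- chart_ball U \<phi> x r))"
      using assms(2) by (intro continuous_open_preimage[OF assms(5,4)]) (simp add: compact_imp_closed open_Compl)
    have "smooth_on (S \<inter> P -` (- chart_ball U \<phi> x r)) (\<lambda>s. chart_bump U \<phi> x r (P s))"
      using smooth_on_const[of _ 0]
      by (subst smooth_on_cong[OF op, where g="\<lambda>s. 0"]) (auto simp: chart_bump_zero[OF _ assms(3)])
    moreover have "s \<in> S \<inter> P -` (- chart_ball U \<phi> x r)"
      using s False by (simp add: chart_ball_def)
    ultimately show ?thesis using op by blast
  qed
qed

section \<open>Averaging over the orbits of a proper action\<close>

lemma lie_group_locally_compact_group: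
  fixes AG :: "('g::{group_add, t2_space, second_countable_topology}, 'd::findim_inner) atlas"
  assumes "lie_group AG"
  shows "locally_compact_group TYPE('g)"
proof
  have AG: "smooth_manifold AG"
    using assms by (simp add: lie_group_def)
  show "continuous_on UNIV (\<lambda>(x::'g, y). x + y)" "continuous_on UNIV (uminus :: 'g \<Rightarrow> 'g)"
    using assms by (auto simp: lie_group_def smooth_map_def)
  fix V :: "'g set" assume "open V" "0 \<in> V"
  then obtain U \<phi> r where *: "(U, \<phi>) \<in> AG" "0 \<in> U" "0 < r" "compact (chart_ball U \<phi> 0 r)" "chart_ball U \<phi> 0 r \<subseteq> V"
    by (rule ex_chart_ball[OF AG])
  show "\<exists>\<phi>\<in>Cc_nonneg. 0 < \<phi> 0 \<and> (\<forall>x. x \<notin> V \<longrightarrow> \<phi> x = 0)"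
    using *(5) chart_bump_pos[OF *(2,3), of \<phi>] chart_bump_zero[OF _ *(3), of _ U \<phi> 0]
    by (intro bexI[OF _ chart_bump_Cc_nonneg[OF smooth_manifold_is_chart[OF AG *(1)] *(4,3)]]) auto
qed

lemma inv_into_map_prod:
  assumes "inj_on f A" "inj_on g B" "a \<in> f ` A" "b \<in> g ` B"
  shows "inv_into (A \<times> B) (map_prod f g) (a, b) = (inv_into A f a, inv_into B g b)"
  using assms by (intro inv_into_f_eq map_prod_inj_on) (auto simp: inv_into_into f_inv_into_f)

lemma smooth_action_in_charts:
  assumes "smooth_action AG AM act" "(W, \<kappa>) \<in> AG" "(U, \<phi>) \<in> AM" "(V, \<psi>) \<in> AM"
    and "is_chart W \<kappa>" "is_chart U \<phi>" "open V"
  defines "P \<equiv> \<lambda>(a, z). act (inv_into W \<kappa> a) (inv_into U \<phi> z)"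
  shows "continuous_on (\<kappa> ` W \<times> \<phi> ` U) P"
    and "smooth_on (\<kappa> ` W \<times> \<phi> ` U \<inter> P -` V) (\<lambda>p. \<psi> (P p))"
proof -
  note W = is_chartD[OF assms(5)] and U = is_chartD[OF assms(6)]
  have act: "smooth_map (prod_atlas AG AM) AM (\<lambda>(g, x). act g x)"
    using assms(1) by (simp add: smooth_action_def)
  have inv: "continuous_on (\<kappa> ` W \<times> \<phi> ` U) (\<lambda>p. (inv_into W \<kappa> (fst p), inv_into U \<phi> (snd p)))"
    by (intro continuous_intros continuous_on_compose2[OF W(5)] continuous_on_compose2[OF U(5)]) auto
  have "continuous_on (\<kappa> ` W \<times> \<phi> ` U) (\<lambda>p. (\<lambda>(g, x). act g x) (inv_into W \<kappa> (fst p), inv_into U \<phi> (snd p)))"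
    using act by (intro continuous_on_compose2[OF _ inv]) (auto simp: smooth_map_def)
  then show cont: "continuous_on (\<kappa> ` W \<times> \<phi> ` U) P"
    by (simp add: P_def case_prod_beta)
  have eq: "map_prod \<kappa> \<phi> ` (W \<times> U \<inter> (\<lambda>(g, x). act g x) -` V) = \<kappa> ` W \<times> \<phi> ` U \<inter> P -` V"
    using W(3) U(3) by (force simp: P_def image_iff)
  have op: "open (\<kappa> ` W \<times> \<phi> ` U \<inter> P -` V)"
    using W(2) U(2) assms(7) by (intro continuous_open_preimage[OF cont] open_Times)
  have "(W \<times> U, map_prod \<kappa> \<phi>) \<in> prod_atlas AG AM"
    using assms(2,3) by (auto simp: prod_atlas_def)
  then have "smooth_on (map_prod \<kappa> \<phi> ` (W \<times> U \<inter> (\<lambda>(g, x). act g x) -` V))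
      (\<psi> \<circ> (\<lambda>(g, x). act g x) \<circ> inv_into (W \<times> U) (map_prod \<kappa> \<phi>))"
    using act assms(4) unfolding smooth_map_def by fast
  then show "smooth_on (\<kappa> ` W \<times> \<phi> ` U \<inter> P -` V) (\<lambda>p. \<psi> (P p))"
    unfolding eq
    by (subst smooth_on_cong[OF op, where g="\<psi> \<circ> (\<lambda>(g, x). act g x) \<circ> inv_into (W \<times> U) (map_prod \<kappa> \<phi>)"])
      (auto simp: P_def inv_into_map_prod[OF W(3) U(3)])
qed

text \<open>The set is the projection of the preimage of \<open>K \<times> L\<close> under a proper
  map. With \<open>L\<close> a point it bounds the support along one orbit, with \<open>L\<close> a
  compact neighbourhood it does so uniformly in the point.\<close>

lemma proper_action_compact:
  assumes "proper_action act" "compact K" "compact L"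
  shows "compact {g. \<exists>x\<in>L. act g x \<in> K}"
proof -
  have "compactin euclidean (K \<times> L)"
    using assms(2,3) by (simp add: compact_Times)
  then have "compact ((\<lambda>(g, x). (act g x, x)) -` (K \<times> L))"
    using compactin_proper_map_preimage[OF assms(1)[unfolded proper_action_def]] by (simp add: vimage_def)
  then have "compact (fst ` ((\<lambda>(g, x). (act g x, x)) -` (K \<times> L)))"
    by (intro compact_continuous_image continuous_intros)
  moreover have "fst ` ((\<lambda>(g, x). (act g x, x)) -` (K \<times> L)) = {g. \<exists>x\<in>L. act g x \<in> K}"
  proof (intro equalityI subsetI)
    fix g assume "g \<in> {g. \<exists>x\<in>L. act g x \<in> K}"
    then obtain x where "(g, x) \<in> (\<lambda>(g, x). (act g x, x)) -` (K \<times> L)"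
      by auto
    then show "g \<in> fst ` ((\<lambda>(g, x). (act g x, x)) -` (K \<times> L))"
      by (rule image_eqI[rotated]) simp
  qed auto
  ultimately show ?thesis by simp
qed

theorem ex_invariant_bump:
  fixes AG :: "('g::{group_add, t2_space, second_countable_topology}, 'd::findim_inner) atlas"
    and AM :: "('m::{t2_space, second_countable_topology}, 'e::findim_inner) atlas"
  assumes G: "lie_group AG" and M: "smooth_manifold AM" and act: "smooth_action AG AM act"
    and proper: "proper_action act"
    and V: "open V" "x0 \<in> V" "\<And>g x. x \<in> V \<Longrightarrow> act g x \<in> V"
  obtains b where "b \<in> smooth_functions AM" "\<And>g x. b (act g x) = b x" "\<And>x. 0 \<le> b x" "0 < b x0"
    "\<And>x. x \<notin> V \<Longrightarrow> b x = 0"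
proof -
  interpret locally_compact_group "TYPE('g)"
    using G by (rule lie_group_locally_compact_group)
  obtain J :: "('g \<Rightarrow> real) \<Rightarrow> real" where J: "positive_functional J"
    "\<And>f t. f \<in> Cc \<Longrightarrow> J (\<lambda>x. f (x + t)) = J f"
    "\<And>f x. f \<in> Cc_nonneg \<Longrightarrow> 0 < f x \<Longrightarrow> 0 < J f"
    by (rule ex_haar_functional) blast
  interpret positive_functional J by (rule J(1))
  have AG: "smooth_manifold AG"
    using G by (simp add: lie_group_def)
  have act_0: "act 0 x = x" and act_add: "act (g + h) x = act g (act h x)" for g h x
    using act by (auto simp: smooth_action_def)
  have act_cont: "continuous_on UNIV (\<lambda>(g, x). act g x)"
    using act by (simp add: smooth_action_def smooth_map_def)
  obtain U0 \<phi>0 r where U0: "(U0, \<phi>0) \<in> AM" "x0 \<in> U0" "0 < r" "compact (chart_ball U0 \<phi>0 x0 r)"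
      "chart_ball U0 \<phi>0 x0 r \<subseteq> V"
    using ex_chart_ball[OF M V(1,2)] by metis
  note chart0 = smooth_manifold_is_chart[OF M U0(1)]
  define \<beta> where "\<beta> = chart_bump U0 \<phi>0 x0 r"
  have \<beta>: "\<beta> \<in> Cc_nonneg" "0 < \<beta> x0" "\<And>x. x \<notin> chart_ball U0 \<phi>0 x0 r \<Longrightarrow> \<beta> x = 0"
    unfolding \<beta>_def using chart_bump_Cc_nonneg[OF chart0 U0(4,3)] chart_bump_pos[OF U0(2,3)]
      chart_bump_zero[OF _ U0(3)] by auto
  have orbit_Cc: "(\<lambda>g. \<beta> (act g x)) \<in> Cc_nonneg" for x
  proof -
    have "continuous_on UNIV (\<lambda>g. (\<lambda>(g, x). act g x) (g, x))"
      by (intro continuous_on_compose2[OF act_cont] continuous_intros) auto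
    then have "continuous_on UNIV (\<lambda>g. \<beta> (act g x))"
      using Cc_imp_continuous[OF Cc_nonnegD(1)[OF \<beta>(1)]] by (auto intro: continuous_on_compose2)
    moreover have "compact {g. \<exists>x\<in>{x}. act g x \<in> chart_ball U0 \<phi>0 x0 r}"
      by (intro proper_action_compact proper U0(4)) simp
    ultimately show ?thesis
      using \<beta>(3) Cc_nonnegD(2)[OF \<beta>(1)] by (auto simp: Cc_nonneg_def Cc_def)
  qed
  define b where "b x = J (\<lambda>g. \<beta> (act g x))" for x
  show ?thesis
  proof (rule that)
    \<comment> \<open>The action is a left action, so moving the point by \<open>h\<close>
      translates the integrand on the right; this is why right invariance is the one
      required.\<close>
    show "b (act h x) = b x" for h x
      using J(2)[OF Cc_nonnegD(1)[OF orbit_Cc[of x]], of h] by (simp add: b_def act_add)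
    show "0 \<le> b x" for x
      unfolding b_def by (rule nonneg[OF orbit_Cc])
    show "0 < b x0"
      unfolding b_def using J(3)[OF orbit_Cc[of x0], of 0] \<beta>(2) by (simp add: act_0)
    show "b x = 0" if "x \<notin> V" for x
    proof -
      \<comment> \<open>Acting by \<open>- g\<close> would carry membership back to
        \<open>x\<close>, so the whole orbit misses \<open>V\<close>.\<close>
      have "act g x \<notin> V" for g
        using that V(3)[of "act g x" "- g"] by (auto simp: act_0 simp flip: act_add)
      then have "\<beta> (act g x) = 0" for g
        using \<beta>(3) U0(5) by blast
      then show ?thesis
        using cmult[OF Cc_zero, of 0] by (simp add: b_def)
    qed
    show "b \<in> smooth_functions AM"
      unfolding smooth_functions_def
    proof safe
      fix U \<phi> assume U: "(U, \<phi>) \<in> AM"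
      note chart = is_chartD[OF smooth_manifold_is_chart[OF M U]]
      show "smooth_on (\<phi> ` U) (b \<circ> inv_into U \<phi>)"
      proof (rule smooth_on_local)
        fix z0 assume "z0 \<in> \<phi> ` U"
        then obtain s where s: "0 < s" "cball z0 s \<subseteq> \<phi> ` U"
          using chart(2) open_contains_cball by blast
        \<comment> \<open>The closed ball makes this set compact, and the open ball inside it is the
          parameter domain. Every \<open>g\<close> at which the integrand can be nonzero lies in
          \<open>K\<close>, for all parameters simultaneously.\<close>
        define K where "K = {g. \<exists>x\<in>inv_into U \<phi> ` cball z0 s. act g x \<in> chart_ball U0 \<phi>0 x0 r}"
        have K: "compact K"
          unfolding K_def using s(2)
          by (intro proper_action_compact proper U0(4) compact_continuous_image compact_cball_findim
              continuous_on_subset[OF chart(5)])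
        obtain f0 :: "'g \<Rightarrow> real" where f0: "f0 \<in> Cc_nonneg" "0 < f0 0"
          using ex_bump[of UNIV] by auto
        \<comment> \<open>Covering \<open>K\<close> by translates of one bump supplies the majorant
          that \<open>smooth_family\<close> asks for.\<close>
        obtain us where us: "\<forall>(c, s)\<in>set us. 0 \<le> c" "\<forall>x\<in>K. 1 \<le> translates us f0 x"
          using ex_dominates_compact[OF K f0] by blast
        interpret smooth_family J AG "ball z0 s" K "translates us f0"
          using AG K us Cc_nonneg_translates[OF us(1) f0(1)] by unfold_locales auto
        have "family (\<lambda>g z. \<beta> (act g (inv_into U \<phi> z)))"
          unfolding family_def
        proof safe
          fix g z assume "z \<in> ball z0 s" "g \<notin> K"
          then have "act g (inv_into U \<phi> z) \<notin> chart_ball U0 \<phi>0 x0 r"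
            by (auto simp: K_def)
          then show "\<beta> (act g (inv_into U \<phi> z)) = 0"
            by (rule \<beta>(3))
        next
          fix W \<kappa> assume W: "(W, \<kappa>) \<in> AG"
          note chartW = smooth_manifold_is_chart[OF AG W]
          let ?P = "\<lambda>(a, z). act (inv_into W \<kappa> a) (inv_into U \<phi> z)"
          note P = smooth_action_in_charts[OF act W U U0(1) chartW smooth_manifold_is_chart[OF M U]
              is_chartD(1)[OF chart0]]
          have "smooth_on (\<kappa> ` W \<times> \<phi> ` U) (\<lambda>p. \<beta> (?P p))"
            unfolding \<beta>_def
            using is_chartD(2)[OF chartW] chart(2) P
            by (intro smooth_on_chart_bump[OF chart0 U0(4,3)] open_Times)
          then have "smooth_on (\<kappa> ` W \<times> ball z0 s) (\<lambda>p. \<beta> (?P p))"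
            by (rule smooth_on_subset) (use s(2) ball_subset_cball in blast)
          then show "smooth_on (\<kappa> ` W \<times> ball z0 s) (\<lambda>(a, z). \<beta> (act (inv_into W \<kappa> a) (inv_into U \<phi> z)))"
            by (simp add: case_prod_unfold)
        qed
        from smooth_on_integral[OF this]
        have "smooth_on (ball z0 s) (b \<circ> inv_into U \<phi>)"
          by (simp add: b_def[abs_def] comp_def)
        with s(1) show "\<exists>T. open T \<and> z0 \<in> T \<and> smooth_on T (b \<circ> inv_into U \<phi>)"
          by (intro exI[of _ "ball z0 s"]) auto
      qed
    qed
  qed
qed

section \<open>The algebra of smooth functions on a manifold\<close>

locale smooth_atlas =
  fixes A :: "('m::{t2_space, second_countable_topology}, 'e::findim_inner) atlas"
  assumes manifold: "smooth_manifold A"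
begin

lemma chart: "(U, \<phi>) \<in> A \<Longrightarrow> is_chart U \<phi>"
  using manifold by (rule smooth_manifold_is_chart)

lemma smooth_functionsI:
  "(\<And>U \<phi>. (U, \<phi>) \<in> A \<Longrightarrow> smooth_on (\<phi> ` U) (\<lambda>z. h (inv_into U \<phi> z))) \<Longrightarrow> h \<in> smooth_functions A"
  by (auto simp: smooth_functions_def comp_def)

lemma smooth_functionsD:
  "h \<in> smooth_functions A \<Longrightarrow> (U, \<phi>) \<in> A \<Longrightarrow> smooth_on (\<phi> ` U) (\<lambda>z. h (inv_into U \<phi> z))"
  by (auto simp: smooth_functions_def comp_def)

lemma smooth_functions_const: "(\<lambda>x. c) \<in> smooth_functions A"
  by (intro smooth_functionsI smooth_on_const)

lemma smooth_functions_add: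
  assumes "f \<in> smooth_functions A" "g \<in> smooth_functions A"
  shows "(\<lambda>x. f x + g x) \<in> smooth_functions A"
proof (rule smooth_functionsI)
  fix U \<phi> assume U: "(U, \<phi>) \<in> A"
  show "smooth_on (\<phi> ` U) (\<lambda>z. f (inv_into U \<phi> z) + g (inv_into U \<phi> z))"
    by (rule smooth_on_add[OF is_chartD(2)[OF chart[OF U]] assms[THEN smooth_functionsD[OF _ U]]])
qed

lemma smooth_functions_mult:
  assumes "f \<in> smooth_functions A" "g \<in> smooth_functions A"
  shows "(\<lambda>x. f x * g x) \<in> smooth_functions A"
proof (rule smooth_functionsI)
  fix U \<phi> assume U: "(U, \<phi>) \<in> A"
  show "smooth_on (\<phi> ` U) (\<lambda>z. f (inv_into U \<phi> z) * g (inv_into U \<phi> z))"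
    by (rule smooth_on_mult[OF is_chartD(2)[OF chart[OF U]] assms[THEN smooth_functionsD[OF _ U]]])
qed

lemma smooth_functions_compose:
  assumes "f \<in> smooth_functions A" "smooth_on T h" "\<And>x. f x \<in> T"
  shows "(\<lambda>x. h (f x) :: real) \<in> smooth_functions A"
proof (rule smooth_functionsI)
  fix U \<phi> assume U: "(U, \<phi>) \<in> A"
  show "smooth_on (\<phi> ` U) (\<lambda>z. h (f (inv_into U \<phi> z)))"
    using assms(3) by (intro smooth_on_compose[OF is_chartD(2)[OF chart[OF U]] _ smooth_functionsD[OF assms(1) U] assms(2)]) auto
qed

lemma smooth_functions_sum:
  "(\<And>i. i \<in> I \<Longrightarrow> f i \<in> smooth_functions A) \<Longrightarrow> (\<lambda>x. \<Sum>i\<in>I. f i x) \<in> smooth_functions A"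
  by (induction I rule: infinite_finite_induct) (auto intro: smooth_functions_const smooth_functions_add)

lemma smooth_functions_prod:
  "(\<And>i. i \<in> I \<Longrightarrow> f i \<in> smooth_functions A) \<Longrightarrow> (\<lambda>x. \<Prod>i\<in>I. f i x) \<in> smooth_functions A"
  by (induction I rule: infinite_finite_induct) (auto intro: smooth_functions_const smooth_functions_mult)

lemma smooth_functions_local:
  assumes "\<And>x. \<exists>N h'. open N \<and> x \<in> N \<and> h' \<in> smooth_functions A \<and> (\<forall>y\<in>N. h y = h' y)"
  shows "h \<in> smooth_functions A"
proof (intro smooth_functionsI smooth_on_local)
  fix U \<phi> z assume U: "(U, \<phi>) \<in> A" and z: "z \<in> \<phi> ` U"
  obtain N h' where N: "open N" "inv_into U \<phi> z \<in> N" "h' \<in> smooth_functions A" "\<forall>y\<in>N. h y = h' y"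
    using assms by blast
  let ?T = "\<phi> ` U \<inter> inv_into U \<phi> -` N"
  have op: "open ?T"
    using is_chartD(5,2)[OF chart[OF U]] N(1) by (rule continuous_open_preimage)
  have "smooth_on ?T (\<lambda>z. h' (inv_into U \<phi> z))"
    using smooth_functionsD[OF N(3) U] by (rule smooth_on_subset) simp
  then have "smooth_on ?T (\<lambda>z. h (inv_into U \<phi> z))"
    by (subst smooth_on_cong[OF op]) (use N(4) in auto)
  with op N(2) z show "\<exists>T. open T \<and> z \<in> T \<and> smooth_on T (\<lambda>z. h (inv_into U \<phi> z))"
    by blast
qed

lemma smooth_functions_continuous:
  assumes "h \<in> smooth_functions A"
  shows "continuous_on UNIV h"
proof (rule continuous_at_imp_continuous_on, rule ballI)
  fix x
  obtain U \<phi> where U: "(U, \<phi>) \<in> A" "x \<in> U"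
    using smooth_manifold_ex_chart[OF manifold] by blast
  note ch = is_chartD[OF chart[OF U(1)]]
  have "continuous_on U (\<lambda>y. h (inv_into U \<phi> (\<phi> y)))"
    by (rule continuous_on_compose2[OF smooth_on_imp_continuous_on[OF smooth_functionsD[OF assms U(1)]] ch(4)]) simp
  then have "continuous_on U h"
    by (rule continuous_on_eq) (simp add: ch(3))
  then show "isCont h x"
    using ch(1) U(2) by (simp add: continuous_on_eq_continuous_at)
qed

end

section \<open>Weighted averages over a countable family of bumps\<close>

locale bump_cover = smooth_atlas A
  for A :: "('m::{t2_space, second_countable_topology}, 'e::findim_inner) atlas" +
  fixes b :: "nat \<Rightarrow> 'm \<Rightarrow> real"
  assumes smooth: "b n \<in> smooth_functions A" and nonneg: "0 \<le> b n x" and cover: "\<exists>n. 0 < b n x"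
begin

text \<open>
  Near a point where \<open>b m\<close> is positive, the factor \<open>j = m\<close> kills \<open>trim n\<close> for all large \<open>n\<close>;
  and the least \<open>n\<close> with \<open>b n x > 0\<close> has \<open>trim n x > 0\<close>.
\<close>

definition trim :: "nat \<Rightarrow> 'm \<Rightarrow> real" where
  "trim n x = b n x * (\<Prod>j<n. flat_exp 0 (inverse (real (Suc n)) - b j x))"

lemma smooth_trim: "trim n \<in> smooth_functions A"
proof -
  have "(\<lambda>x. flat_exp 0 (inverse (real (Suc n)) + (-1) * b j x)) \<in> smooth_functions A" for j
    by (intro smooth_functions_compose[OF _ smooth_on_flat_exp[of UNIV]] smooth_functions_add
        smooth_functions_mult smooth_functions_const smooth UNIV_I)
  then have "(\<lambda>x. b n x * (\<Prod>j<n. flat_exp 0 (inverse (real (Suc n)) + (-1) * b j x))) \<in> smooth_functions A"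
    by (intro smooth_functions_mult smooth_functions_prod smooth)
  then show ?thesis
    by (simp add: trim_def[abs_def])
qed

lemma trim_nonneg: "0 \<le> trim n x"
  by (simp add: trim_def nonneg prod_nonneg flat_exp_nonneg)

lemma trim_nonzeroD: "trim n x \<noteq> 0 \<Longrightarrow> b n x \<noteq> 0"
  by (auto simp: trim_def)

lemma ex_trim_pos: "\<exists>n. 0 < trim n x"
proof -
  define n where "n = (LEAST n. 0 < b n x)"
  have n: "0 < b n x"
    unfolding n_def using cover by (rule LeastI_ex)
  have "b j x = 0" if "j < n" for j
    using not_less_Least[of j "\<lambda>n. 0 < b n x"] that nonneg[of j x] by (simp add: n_def)
  with n have "0 < trim n x"
    by (auto simp: trim_def flat_exp_pos_iff intro!: mult_pos_pos prod_pos)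
  then show ?thesis ..
qed

lemma locally_finite_trim:
  obtains N k where "open N" "x \<in> N" "\<And>n y. k \<le> n \<Longrightarrow> y \<in> N \<Longrightarrow> trim n y = 0"
proof -
  obtain m where m: "0 < b m x"
    using cover by blast
  obtain l where l: "inverse (real (Suc l)) < b m x / 2"
    using reals_Archimedean[of "b m x / 2"] m by auto
  show ?thesis
  proof
    show "open {y. b m x / 2 < b m y}"
      using smooth_functions_continuous[OF smooth] by (intro open_Collect_less continuous_intros)
    show "x \<in> {y. b m x / 2 < b m y}"
      using m by simp
    \<comment> \<open>The bound \<open>Suc m\<close> brings the index \<open>m\<close> into the
      product over \<open>j < n\<close>, and the bound \<open>l\<close> pushes the threshold
      \<open>inverse (real (Suc n))\<close> below \<open>b m y\<close>.\<close>
    fix n y assume n: "max l (Suc m) \<le> n" and y: "y \<in> {y. b m x / 2 < b m y}"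
    have "inverse (real (Suc n)) \<le> inverse (real (Suc l))"
      using n by (intro le_imp_inverse_le) auto
    then have "inverse (real (Suc n)) \<le> b m y"
      using l y unfolding mem_Collect_eq by linarith
    then have "flat_exp 0 (inverse (real (Suc n)) - b m y) = 0"
      by (simp add: flat_exp_def)
    then have "(\<Prod>j<n. flat_exp 0 (inverse (real (Suc n)) - b j y)) = 0"
      using n by (intro prod_zero) auto
    then show "trim n y = 0"
      by (simp add: trim_def)
  qed
qed

definition total :: "(nat \<Rightarrow> real) \<Rightarrow> 'm \<Rightarrow> real" where
  "total w x = (\<Sum>n. w n * trim n x)"

lemma total_eq_sum:
  "(\<And>n. k \<le> n \<Longrightarrow> trim n x = 0) \<Longrightarrow> total w x = (\<Sum>n<k. w n * trim n x)"
  unfolding total_def by (rule suminf_finite) auto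

lemma smooth_total: "total w \<in> smooth_functions A"
proof (rule smooth_functions_local)
  fix x
  obtain N k where N: "open N" "x \<in> N" "\<And>n y. k \<le> n \<Longrightarrow> y \<in> N \<Longrightarrow> trim n y = 0"
    using locally_finite_trim[of x] by metis
  have "(\<lambda>y. \<Sum>n<k. w n * trim n y) \<in> smooth_functions A"
    by (intro smooth_functions_sum smooth_functions_mult smooth_functions_const smooth_trim)
  moreover have "\<forall>y\<in>N. total w y = (\<Sum>n<k. w n * trim n y)"
    using total_eq_sum N(3) by blast
  ultimately show "\<exists>N h'. open N \<and> x \<in> N \<and> h' \<in> smooth_functions A \<and> (\<forall>y\<in>N. total w y = h' y)"
    using N(1,2) by blast
qed

definition average :: "(nat \<Rightarrow> real) \<Rightarrow> 'm \<Rightarrow> real" where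
  "average w x = total w x * inverse (total (\<lambda>n. 1) x)"

lemma total_one_pos: "0 < total (\<lambda>n. 1) x"
proof -
  obtain N k where N: "x \<in> N" "\<And>n y. k \<le> n \<Longrightarrow> y \<in> N \<Longrightarrow> trim n y = 0"
    using locally_finite_trim[of x] by metis
  obtain m where m: "0 < trim m x"
    using ex_trim_pos by blast
  then have "m < k"
    using N by (metis less_irrefl not_le)
  then have "0 < (\<Sum>n<k. trim n x)"
    using m trim_nonneg by (intro sum_pos2[of _ m]) auto
  then show ?thesis
    using total_eq_sum[of k x "\<lambda>n. 1"] N by simp
qed

lemma smooth_average: "average w \<in> smooth_functions A"
proof -
  have "smooth_on (- {0}) (inverse :: real \<Rightarrow> real)"
    by (simp add: smooth_on_def Ck_on_inverse)
  then have "(\<lambda>x. inverse (total (\<lambda>n. 1) x)) \<in> smooth_functions A"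
    using total_one_pos by (intro smooth_functions_compose[OF smooth_total]) (auto simp: less_imp_neq[symmetric])
  then show ?thesis
    unfolding average_def[abs_def] by (intro smooth_functions_mult smooth_total)
qed

text \<open>Only indices with \<open>b n x \<noteq> 0\<close> carry weight, so the average is a
  finite convex combination of values close to \<open>c\<close>. Strictness survives because at
  least one weight is positive.\<close>

lemma average_close:
  assumes "\<And>n. b n x \<noteq> 0 \<Longrightarrow> \<bar>w n - c\<bar> < \<delta>"
  shows "\<bar>average w x - c\<bar> < \<delta>"
proof -
  obtain N k where N: "x \<in> N" "\<And>n y. k \<le> n \<Longrightarrow> y \<in> N \<Longrightarrow> trim n y = 0"
    using locally_finite_trim[of x] by metis
  then have total: "total w x = (\<Sum>n<k. w n * trim n x)" for w
    by (intro total_eq_sum) blast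
  obtain m where m: "0 < trim m x"
    using ex_trim_pos by blast
  then have "m < k"
    using N by (metis less_irrefl not_le)
  have le: "\<bar>(w n - c) * trim n x\<bar> \<le> \<delta> * trim n x" for n
  proof (cases "trim n x = 0")
    case False
    then show ?thesis
      using assms[OF trim_nonzeroD[OF False]] trim_nonneg[of n x] by (simp add: abs_mult mult_right_mono)
  qed simp
  have "total w x - c * total (\<lambda>n. 1) x = (\<Sum>n<k. (w n - c) * trim n x)"
    by (simp add: total sum_distrib_left left_diff_distrib sum_subtractf)
  also have "\<bar>\<dots>\<bar> \<le> (\<Sum>n<k. \<bar>(w n - c) * trim n x\<bar>)"
    by (rule sum_abs)
  also have "\<dots> < (\<Sum>n<k. \<delta> * trim n x)"
  proof (rule sum_strict_mono_ex1)
    have "\<bar>(w m - c) * trim m x\<bar> < \<delta> * trim m x"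
      using assms[of m] trim_nonzeroD[of m x] m by (simp add: abs_mult)
    then show "\<exists>n\<in>{..<k}. \<bar>(w n - c) * trim n x\<bar> < \<delta> * trim n x"
      using \<open>m < k\<close> by blast
  qed (use le in auto)
  also have "\<dots> = \<delta> * total (\<lambda>n. 1) x"
    by (simp add: total sum_distrib_left)
  finally have "\<bar>total w x - c * total (\<lambda>n. 1) x\<bar> / total (\<lambda>n. 1) x < \<delta>"
    using total_one_pos[of x] by (simp add: pos_divide_less_eq)
  moreover have "average w x - c = (total w x - c * total (\<lambda>n. 1) x) / total (\<lambda>n. 1) x"
    using total_one_pos[of x] by (simp add: average_def field_simps)
  ultimately show ?thesis
    using total_one_pos[of x] by simp
qed

text \<open>The point enters only through the values of the bumps, so invariance of the bumps passes
  to the average.\<close>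

lemma average_cong: "(\<And>n. b n x = b n y) \<Longrightarrow> average w x = average w y"
  by (simp add: average_def total_def trim_def)

end

theorem lemma4p7:
  fixes AG :: "('g::{group_add, t2_space, second_countable_topology}, 'd::findim_inner) atlas"
    and AM :: "('m::{t2_space, second_countable_topology}, 'e::findim_inner) atlas"
    and act :: "'g \<Rightarrow> 'm \<Rightarrow> 'm"
    and f :: "'m set \<Rightarrow> real"
    and \<delta> :: real
  assumes "lie_group AG"
    and "smooth_manifold AM"
    and "smooth_action AG AM act"
    and "proper_action act"
    and "continuous_map (orbit_topology act) euclideanreal f"
    and "\<delta> > 0"
  shows "\<exists>g\<in>orbit_smooth_functions AM act. \<forall>y\<in>orbit_space act. \<bar>g y - f y\<bar> < \<delta>"
proof -
  have act_0: "act 0 x = x" and act_add: "act (g + h) x = act g (act h x)" for g h x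
    using assms(3) by (auto simp: smooth_action_def)
  have orbit_act: "orbit_map act (act g x) = orbit_map act x" for g x
    unfolding orbit_map_def
  proof (intro equalityI subsetI)
    fix y assume "y \<in> range (\<lambda>h. act h x)"
    then obtain h where "y = act h x" by blast
    then have "y = act (h + - g) (act g x)"
      by (simp add: add.assoc flip: act_add)
    then show "y \<in> range (\<lambda>h. act h (act g x))" by blast
  qed (auto simp flip: act_add)
  define F where "F x = f (orbit_map act x)" for x
  have F_act: "F (act g x) = F x" for g x
    by (simp add: F_def orbit_act)
  \<comment> \<open>An invariant set, since \<open>F\<close> is invariant. Where a bump supported in
    \<open>V p\<close> is nonzero, the value \<open>F p\<close> attached to it differs from
    \<open>F\<close> by less than \<open>\<delta>\<close>.\<close>
  define V where "V p = {x. \<bar>F p - F x\<bar> < \<delta>}" for p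
  have V_open: "open (V p)" for p
  proof -
    have "openin (orbit_topology act) {y \<in> topspace (orbit_topology act). f y \<in> {t. \<bar>F p - t\<bar> < \<delta>}}"
      by (intro openin_continuous_map_preimage[OF assms(5)])
        (auto intro!: open_Collect_less continuous_intros)
    moreover have "orbit_map act -` {y \<in> topspace (orbit_topology act). f y \<in> {t. \<bar>F p - t\<bar> < \<delta>}} = V p"
      by (auto simp: V_def F_def topspace_orbit_topology orbit_space_def)
    ultimately show ?thesis
      by (simp add: openin_orbit_topology)
  qed
  have "\<exists>b. b \<in> smooth_functions AM \<and> (\<forall>g x. b (act g x) = b x) \<and> (\<forall>x. 0 \<le> b x) \<and> 0 < b p \<and>
      (\<forall>x. x \<notin> V p \<longrightarrow> b x = 0)" for p
  proof -
    have "p \<in> V p" "\<And>g x. x \<in> V p \<Longrightarrow> act g x \<in> V p"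
      using assms(6) by (auto simp: V_def F_act)
    from ex_invariant_bump[OF assms(1-4) V_open this] show ?thesis
      by metis
  qed
  then obtain b where b: "\<And>p. b p \<in> smooth_functions AM" "\<And>p g x. b p (act g x) = b p x"
      "\<And>p x. 0 \<le> b p x" "\<And>p. 0 < b p p" "\<And>p x. x \<notin> V p \<Longrightarrow> b p x = 0"
    by metis
  interpret smooth_atlas AM
    using assms(2) by unfold_locales
  have op: "open {x. 0 < b p x}" for p
    using smooth_functions_continuous[OF b(1)] by (intro open_Collect_less continuous_intros)
  obtain \<D> where \<D>: "\<D> \<subseteq> range (\<lambda>p. {x. 0 < b p x})" "countable \<D>" "\<Union>\<D> = \<Union>(range (\<lambda>p. {x. 0 < b p x}))"
    using Lindelof[of "range (\<lambda>p. {x. 0 < b p x})"] op by auto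
  then obtain D where D: "countable D" "\<D> = (\<lambda>p. {x. 0 < b p x}) ` D"
    by (metis countable_subset_image)
  have cover: "\<exists>p\<in>D. 0 < b p x" for x
    using \<D>(3) b(4)[of x] unfolding D(2) by blast
  then have "D \<noteq> {}" by blast
  \<comment> \<open>If \<open>D\<close> is finite, the enumeration repeats points; the cover
    condition concerns only its range.\<close>
  define p where "p = from_nat_into D"
  have range_p: "range p = D"
    unfolding p_def by (rule range_from_nat_into[OF \<open>D \<noteq> {}\<close> D(1)])
  interpret bump_cover AM "\<lambda>n. b (p n)"
    using b(1,3) cover range_p by unfold_locales auto
  define \<gamma> where "\<gamma> = average (\<lambda>n. F (p n))"
  have \<gamma>_act: "\<gamma> (act g x) = \<gamma> x" for g x
    unfolding \<gamma>_def by (rule average_cong) (rule b(2))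
  have \<gamma>_close: "\<bar>\<gamma> x - F x\<bar> < \<delta>" for x
    unfolding \<gamma>_def using b(5) by (intro average_close) (auto simp: V_def)
  \<comment> \<open>The average descends to orbits by evaluation at a chosen point; by invariance
    the choice does not affect the value.\<close>
  define h where "h y = \<gamma> (SOME x. x \<in> y)" for y
  have h: "h (orbit_map act x) = \<gamma> x" for x
  proof -
    have "(SOME z. z \<in> orbit_map act x) \<in> orbit_map act x"
      by (rule someI[of _ "act 0 x"]) (auto simp: orbit_map_def)
    then show ?thesis
      by (auto simp: h_def orbit_map_def \<gamma>_act)
  qed
  then have "h \<circ> orbit_map act = \<gamma>"
    by auto
  then have "h \<in> orbit_smooth_functions AM act"
    using smooth_average by (simp add: orbit_smooth_functions_def \<gamma>_def)
  moreover have "\<forall>y\<in>orbit_space act. \<bar>h y - f y\<bar> < \<delta>"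
    using \<gamma>_close by (auto simp: orbit_space_def h F_def)
  ultimately show ?thesis by blast
qed

end
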